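(* Let $f\in BV_{||0||}(\mathbb{R}^2)$ and let $(u_n)_{n\in\mathbb{N}},(v_m)_{m\in\mathbb{N}}\in(L)$ with constants $A_1$ and $A_2$, respectively. Then, for each $(x,y)\in\mathbb{R}^2$, $$\sum_{i,j=2}^{\infty}\ \sup_{u\in[u_{i-1},u_i]}\ \sup_{v\in[v_{j-1},v_j]}\left|\frac{1}{4\pi^2}\iint_{R_{u_{i-1},v_{j-1}}^{u,v}}\mathcal{F}(f)(\xi,\eta)\,e^{i(x\xi+y\eta)}\,d(\xi,\eta)\right|\le k\,Var(f,\mathbb{R}^2),$$ where $k=(3A_1+4)(3A_2+4)/\pi^2$.
   Context: For a real function $f$ and points $x_{i-1}\le x_i$, $y_{j-1}\le y_j$ put $\Delta f(x_i,y_j)=f(x_i,y_j)-f(x_{i-1},y_j)-f(x_i,y_{j-1})+f(x_{i-1},y_{j-1})$. A partition of a compact rectangle $R=[a,b]\times[c,d]$ is a finite grid of cells $[x_{i-1},x_i]\times[y_{j-1},y_j]$ with $a=x_0<\dots<x_n=b$, $c=y_0<\dots<y_m=d$. A function $f:\mathbb{R}^2\to\mathbb{R}$ is of bounded variation in the Vitali sense, $f\in BV_V(\mathbb{R}^2)$, if $Var(f,\mathbb{R}^2)=\sup_R\sup\sum_{i,j}|\Delta f(x_i,y_j)|<\infty$, the suprema being over compact rectangles $R\subset\mathbb{R}^2$ and partitions of $R$. $BV_{||0||}(\mathbb{R}^2)$ is the set of $f\in BV_V(\mathbb{R}^2)$ with $\lim_{\|(x,y)\|\to\infty}f(x,y)=0$.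 The KP-Fourier transform of $f$ at $(\xi,\eta)$ is $$\mathcal F(f)(\xi,\eta)=\lim_{\substack{a,c\to-\infty\\ b,d\to\infty}}\iint_{[a,b]\times[c,d]}f(t_1,t_2)e^{-i(\xi t_1+\eta t_2)}\,d(t_1,t_2),$$ when this limit exists in the Pringsheim sense (i.e. as a joint limit with $a,c\to-\infty$ and $b,d\to\infty$ independently); the integrals over compact rectangles are Kurzweil–Henstock integrals (agreeing with the Lebesgue integral for Lebesgue integrable integrands). For $f\in BV_{||0||}(\mathbb{R}^2)$ it is defined whenever $\xi\ne0$ and $\eta\neq 0$. For $0<\alpha_i\le\beta_i<\infty$, $R_{\alpha_1,\alpha_2}^{\beta_1,\beta_2}=\{(\xi,\eta)\in\mathbb{R}^2:\alpha_1\le|\xi|\le\beta_1,\ \alpha_2\le|\eta|\le\beta_2\}$. An increasing sequence $(u_j)_{j\in\mathbb{N}}$ of positive reals ($\mathbb N=\{1,2,\dots\}$) satisfies condition $(L)$ with constant $A$, written $(u_j)\in(L)$, if $A>1$ and $u_m\sum_{j=m}^\infty\frac1{u_j}\le A$ for all $m=1,2,3,\dots$. *)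

theory Defs
  imports "HOL-Analysis.Analysis"
begin

definition Delta :: "(real \<times> real \<Rightarrow> real) \<Rightarrow> real \<Rightarrow> real \<Rightarrow> real \<Rightarrow> real \<Rightarrow> real" where
  "Delta f x' x y' y = f (x, y) - f (x', y) - f (x, y') + f (x', y')"

definition grid_points :: "real \<Rightarrow> real \<Rightarrow> nat \<Rightarrow> (nat \<Rightarrow> real) \<Rightarrow> bool" where
  "grid_points a b n p \<longleftrightarrow> p 0 = a \<and> p n = b \<and> (\<forall>i\<in>{1..n}. p (i - 1) < p i)"

(* Variations are extended nonnegative reals, so that the suprema always make sense;
   the supremum of the empty set is 0. *)
definition vitali_var_on ::
    "(real \<times> real \<Rightarrow> real) \<Rightarrow> real \<Rightarrow> real \<Rightarrow> real \<Rightarrow> real \<Rightarrow> ennreal" where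
  "vitali_var_on f a b c d =
     (SUP (n, p, m, q) \<in> {(n, p, m, q). grid_points a b n p \<and> grid_points c d m q}.
        \<Sum>i=1..n. \<Sum>j=1..m. ennreal \<bar>Delta f (p (i - 1)) (p i) (q (j - 1)) (q j)\<bar>)"

definition vitali_var :: "(real \<times> real \<Rightarrow> real) \<Rightarrow> ennreal" where
  "vitali_var f = (SUP (a, b, c, d) \<in> {(a, b, c, d). a \<le> b \<and> c \<le> d}. vitali_var_on f a b c d)"

definition BV_V :: "(real \<times> real \<Rightarrow> real) set" where
  "BV_V = {f. vitali_var f < \<infinity>}"

definition BV_norm0 :: "(real \<times> real \<Rightarrow> real) set" where
  "BV_norm0 = {f \<in> BV_V. (f \<longlongrightarrow> 0) at_infinity}"

definition KP_integrand ::
    "(real \<times> real \<Rightarrow> real) \<Rightarrow> real \<Rightarrow> real \<Rightarrow> real \<times> real \<Rightarrow> complex" where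
  "KP_integrand f \<xi> \<eta> =
     (\<lambda>(t1, t2). complex_of_real (f (t1, t2)) * exp (- (\<i> * complex_of_real (\<xi> * t1 + \<eta> * t2))))"

definition KP_truncated ::
    "(real \<times> real \<Rightarrow> real) \<Rightarrow> real \<Rightarrow> real \<Rightarrow> real \<times> real \<times> real \<times> real \<Rightarrow> complex" where
  "KP_truncated f \<xi> \<eta> =
     (\<lambda>(a, b, c, d). integral ({a..b} \<times> {c..d}) (KP_integrand f \<xi> \<eta>))"

(* Pringsheim limits: a, c tend to -infinity and b, d to infinity, independently;
   the tuple is ordered as (a, b, c, d). *)
definition pringsheim :: "(real \<times> real \<times> real \<times> real) filter" where
  "pringsheim = at_bot \<times>\<^sub>F at_top \<times>\<^sub>F at_bot \<times>\<^sub>F at_top"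

(* Since integral and Lim are total functions, the existence of the integrals and of the
   limit is recorded separately from the value of the transform. *)
definition KP_Fourier_exists :: "(real \<times> real \<Rightarrow> real) \<Rightarrow> real \<Rightarrow> real \<Rightarrow> bool" where
  "KP_Fourier_exists f \<xi> \<eta> \<longleftrightarrow>
     (\<forall>a b c d. KP_integrand f \<xi> \<eta> integrable_on ({a..b} \<times> {c..d})) \<and>
     (\<exists>L. (KP_truncated f \<xi> \<eta> \<longlongrightarrow> L) pringsheim)"

definition KP_Fourier :: "(real \<times> real \<Rightarrow> real) \<Rightarrow> real \<Rightarrow> real \<Rightarrow> complex" where
  "KP_Fourier f \<xi> \<eta> = Lim pringsheim (KP_truncated f \<xi> \<eta>)"

definition freq_rect :: "real \<Rightarrow> real \<Rightarrow> real \<Rightarrow> real \<Rightarrow> (real \<times> real) set" where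
  "freq_rect \<alpha>1 \<alpha>2 \<beta>1 \<beta>2 =
     {(\<xi>, \<eta>). \<alpha>1 \<le> \<bar>\<xi>\<bar> \<and> \<bar>\<xi>\<bar> \<le> \<beta>1 \<and> \<alpha>2 \<le> \<bar>\<eta>\<bar> \<and> \<bar>\<eta>\<bar> \<le> \<beta>2}"

definition inversion_integrand ::
    "(real \<times> real \<Rightarrow> real) \<Rightarrow> real \<Rightarrow> real \<Rightarrow> real \<times> real \<Rightarrow> complex" where
  "inversion_integrand f x y =
     (\<lambda>(\<xi>, \<eta>). KP_Fourier f \<xi> \<eta> * exp (\<i> * complex_of_real (x * \<xi> + y * \<eta>)))"

(* Sequences are indexed from 1 (the value at 0 is irrelevant), and increasing is understood
   in the weak sense, which includes the strict one.  Summability is explicit because the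
   suminf of a divergent real series is not infinite. *)
definition cond_L :: "real \<Rightarrow> (nat \<Rightarrow> real) \<Rightarrow> bool" where
  "cond_L A u \<longleftrightarrow>
     A > 1 \<and> (\<forall>j\<ge>1. 0 < u j) \<and> mono_on {1..} u \<and>
     (\<forall>m\<ge>1. summable (\<lambda>j. 1 / u (m + j)) \<and> u m * (\<Sum>j. 1 / u (m + j)) \<le> A)"

end

theory Submission
  imports Defs
begin

text \<open>
  The function \<open>f\<close> is treated as the distribution function of its mixed differences, without
  constructing the measure. Two observations carry the argument. Variation is superadditive over
  disjoint strips, so the variation of \<open>f\<close> far out is small, and \<open>f\<close> is continuous off countably
  many horizontal and vertical lines; hence sampling \<open>f\<close> on uniform grids recovers all integrals over
  rectangles by dominated convergence. Since \<open>f\<close> vanishes at infinity, a sampled function may be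
  framed by zeros, and summation by parts in both variables gives
  \<open>\<Sum> f(x\<^sub>i, y\<^sub>j) \<Delta>K(x\<^sub>i) \<Delta>L(y\<^sub>j) = \<Sum> \<delta>\<^sub>i\<^sub>j K(x\<^sub>i) L(y\<^sub>j)\<close> with
  \<open>\<Sum> \<bar>\<delta>\<^sub>i\<^sub>j\<bar> \<le> Var f\<close> for arbitrary antiderivatives \<open>K\<close>, \<open>L\<close> of the kernels.

  With \<open>K(t) = \<i> e\<^bsup>-\<i>\<xi>t\<^esup> / \<xi>\<close> this bounds the truncated transforms by
  \<open>Var f / \<bar>\<xi> \<eta>\<bar>\<close>, and the smallness of the tails gives the Pringsheim limit. Integrating over a
  frequency band turns \<open>K\<close> into \<open>P(t) = \<integral>\<^bsub>\<alpha>\<^esub>\<^bsup>s\<^esup> sin(\<xi>t) / \<xi> d\<xi>\<close>, which is at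
  most \<open>(s - \<alpha>) \<bar>t\<bar>\<close> and at most \<open>2 / (\<alpha> \<bar>t\<bar>)\<close>. Summed over the bands, the first
  estimate telescopes to at most 1 below the frequency \<open>1 / \<bar>t\<bar>\<close>, condition (L) bounds the second by
  \<open>2 A\<close> above it, and the one band containing \<open>1 / \<bar>t\<bar>\<close> contributes at most 3.
\<close>

section \<open>Grid sums and their refinement\<close>

definition grid_sum :: "(real \<times> real \<Rightarrow> real) \<Rightarrow> (nat \<Rightarrow> real) \<Rightarrow> nat \<Rightarrow> (nat \<Rightarrow> real) \<Rightarrow> nat \<Rightarrow> real" where
  "grid_sum f p n q m =
     (\<Sum>i<n. \<Sum>j<m. \<bar>Delta f (p i) (p (Suc i)) (q j) (q (Suc j))\<bar>)"

text \<open>A real constant valid for all finite strictly increasing grids replaces the nested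
  suprema in \<open>ennreal\<close>; the trivial grids force \<open>0 \<le> B\<close>.\<close>

definition grid_bounded :: "(real \<times> real \<Rightarrow> real) \<Rightarrow> real \<Rightarrow> bool" where
  "grid_bounded f B \<longleftrightarrow>
     (\<forall>p n q m. (\<forall>i<n. p i < p (Suc i)) \<longrightarrow> (\<forall>j<m. q j < q (Suc j)) \<longrightarrow> grid_sum f p n q m \<le> B)"

lemma grid_boundedD:
  "\<lbrakk>grid_bounded f B; \<And>i. i < n \<Longrightarrow> p i < p (Suc i); \<And>j. j < m \<Longrightarrow> q j < q (Suc j)\<rbrakk>
   \<Longrightarrow> grid_sum f p n q m \<le> B"
  by (auto simp: grid_bounded_def)

lemma increasing_chain_mono:
  fixes x :: "nat \<Rightarrow> real"
  assumes "\<forall>i<n. x i < x (Suc i)" "i \<le> j" "j \<le> n"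
  shows "x i \<le> x j"
  using assms(2,3)
proof (induction j rule: dec_induct)
  case (step k)
  then show ?case using assms(1)[rule_format, of k] by auto
qed simp

lemma grid_pointsI:
  assumes "\<forall>i<n. p i < p (Suc i)"
  shows "grid_points (p 0) (p n) n p"
  unfolding grid_points_def
proof (intro conjI ballI refl)
  fix i assume "i \<in> {1..n}"
  then show "p (i - 1) < p i" using assms[rule_format, of "i - 1"] by auto
qed

text \<open>Every grid partitions the rectangle spanned by its own end points, so its sum occurs
  among the suprema; finiteness of the variation makes \<open>enn2real\<close> lossless.\<close>

lemma BV_V_grid_bounded:
  assumes "f \<in> BV_V"
  shows "grid_bounded f (enn2real (vitali_var f))"
  unfolding grid_bounded_def
proof (intro allI impI)
  fix p q :: "nat \<Rightarrow> real" and n m :: nat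
  assume p: "\<forall>i<n. p i < p (Suc i)" and q: "\<forall>j<m. q j < q (Suc j)"
  have gp: "grid_points (p 0) (p n) n p" "grid_points (q 0) (q m) m q"
    using p q by (auto intro: grid_pointsI)
  have "ennreal (grid_sum f p n q m) =
      (\<Sum>i=1..n. \<Sum>j=1..m. ennreal \<bar>Delta f (p (i - 1)) (p i) (q (j - 1)) (q j)\<bar>)"
    by (simp add: grid_sum_def sum.atLeast1_atMost_eq sum_nonneg)
  also have "\<dots> \<le> vitali_var_on f (p 0) (p n) (q 0) (q m)"
    unfolding vitali_var_on_def using gp by (intro SUP_upper2[where i = "(n, p, m, q)"]) auto
  also have "\<dots> \<le> vitali_var f"
    unfolding vitali_var_def using increasing_chain_mono[OF p, of 0 n] increasing_chain_mono[OF q, of 0 m]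
    by (intro SUP_upper2[where i = "(p 0, p n, q 0, q m)"]) auto
  also have "\<dots> = ennreal (enn2real (vitali_var f))"
    using assms by (simp add: BV_V_def)
  finally show "grid_sum f p n q m \<le> enn2real (vitali_var f)"
    by simp
qed

text \<open>Mixed differences are symmetric in the two variables, so whatever is proved for vertical
  strips transfers to horizontal ones.\<close>

lemma grid_bounded_swap:
  assumes "grid_bounded f B"
  shows "grid_bounded (f \<circ> prod.swap) B"
  unfolding grid_bounded_def
proof (intro allI impI)
  fix p q :: "nat \<Rightarrow> real" and n m :: nat
  assume p: "\<forall>i<n. p i < p (Suc i)" and q: "\<forall>j<m. q j < q (Suc j)"
  have "grid_sum (f \<circ> prod.swap) p n q m = grid_sum f q m p n"
    unfolding grid_sum_def by (subst sum.swap) (simp add: Delta_def algebra_simps)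
  then show "grid_sum (f \<circ> prod.swap) p n q m \<le> B"
    using assms p q by (simp add: grid_bounded_def)
qed

lemma tendsto_swap_at_infinity:
  fixes f :: "real \<times> real \<Rightarrow> real"
  assumes "(f \<longlongrightarrow> 0) at_infinity"
  shows "((f \<circ> prod.swap) \<longlongrightarrow> 0) at_infinity"
proof -
  have "norm (prod.swap p) = norm p" for p :: "real \<times> real"
    by (cases p) (simp add: norm_Pair add.commute)
  then show ?thesis
    using assms unfolding tendsto_iff eventually_at_infinity o_def by metis
qed

text \<open>Grids are merged as weakly sorted lists: repeated points contribute nothing to the
  variation, so no duplicates have to be removed.\<close>

fun tv :: "(real \<Rightarrow> real) \<Rightarrow> real list \<Rightarrow> real" where
  "tv g (a # b # xs) = \<bar>g b - g a\<bar> + tv g (b # xs)"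
| "tv g _ = 0"

fun tv2 :: "(real \<times> real \<Rightarrow> real) \<Rightarrow> real list \<Rightarrow> real list \<Rightarrow> real" where
  "tv2 f (a # b # xs) ys = tv (\<lambda>y. f (b, y) - f (a, y)) ys + tv2 f (b # xs) ys"
| "tv2 f _ ys = 0"

lemma tv_nonneg: "0 \<le> tv g xs"
  by (induction g xs rule: tv.induct) auto

lemma tv_snoc: "tv g (xs @ [a, b]) = tv g (xs @ [a]) + \<bar>g b - g a\<bar>"
proof (induction xs)
  case (Cons x xs)
  then show ?case by (cases xs) auto
qed auto

lemma tv2_snoc: "tv2 f (xs @ [a, b]) ys = tv2 f (xs @ [a]) ys + tv (\<lambda>y. f (b, y) - f (a, y)) ys"
proof (induction xs)
  case (Cons x xs)
  then show ?case by (cases xs) auto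
qed auto

lemma upt_Suc_Suc_map: "map p [0..<Suc (Suc n)] = map p [0..<n] @ [p n, p (Suc n)]"
  by simp

lemma tv_map_upt: "tv g (map p [0..<Suc n]) = (\<Sum>i<n. \<bar>g (p (Suc i)) - g (p i)\<bar>)"
proof (induction n)
  case (Suc n)
  then show ?case unfolding upt_Suc_Suc_map tv_snoc by simp
qed simp

lemma tv2_map_upt: "tv2 f (map p [0..<Suc n]) (map q [0..<Suc m]) = grid_sum f p n q m"
proof (induction n)
  case (Suc n)
  then show ?case unfolding upt_Suc_Suc_map tv2_snoc tv_map_upt grid_sum_def Delta_def
    by (simp add: algebra_simps)
qed (simp add: grid_sum_def)

lemma tv_remdups_adj: "tv g (remdups_adj xs) = tv g xs"
proof (induction xs rule: remdups_adj.induct)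
  case (3 x y xs)
  obtain zs where "remdups_adj (y # xs) = y # zs"
    by (metis remdups_adj_Cons_alt)
  then show ?case using 3 by (auto split: if_splits)
qed auto

lemma tv_const: "tv (\<lambda>y. 0) ys = 0"
  by (induction "\<lambda>y::real. 0::real" ys rule: tv.induct) auto

lemma tv2_remdups_adj: "tv2 f (remdups_adj xs) ys = tv2 f xs ys"
proof (induction xs rule: remdups_adj.induct)
  case (3 x y xs)
  obtain zs where "remdups_adj (y # xs) = y # zs"
    by (metis remdups_adj_Cons_alt)
  then show ?case using 3 by (auto split: if_splits simp: tv_const)
qed auto

lemma tv2_remdups_adj2: "tv2 f xs (remdups_adj ys) = tv2 f xs ys"
  by (induction f xs ys rule: tv2.induct) (auto simp: tv_remdups_adj)

lemma strict_sorted_remdups_adj: "sorted (xs :: real list) \<Longrightarrow> sorted_wrt (<) (remdups_adj xs)"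
  by (induction xs rule: remdups_adj.induct) (auto simp: less_le)

lemma list_map_nth: "xs \<noteq> [] \<Longrightarrow> xs = map ((!) xs) [0..<Suc (length xs - 1)]"
  using map_nth[of xs] by (cases xs) (simp_all del: upt_Suc)

text \<open>The new point splits one increment in two or adds an increment at an end; the triangle
  inequality does the rest.\<close>

lemma tv_le_insort: "tv g xs \<le> tv g (insort y xs)"
proof (induction g xs rule: tv.induct)
  case (1 g a b xs)
  then show ?case by auto
next
  case ("2_2" g v)
  then show ?case by auto
qed auto

lemma tv2_le_insort: "tv2 f xs ys \<le> tv2 f xs (insort y ys)"
  by (induction f xs ys rule: tv2.induct) (auto intro: add_mono tv_le_insort)

lemma tv2_Nil2: "tv2 f xs [] = 0"
  by (induction f xs "[]::real list" rule: tv2.induct) auto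

text \<open>Deleting repeated neighbours leaves \<open>tv2\<close> unchanged and turns weakly sorted
  lists into strict grids, to which the bound applies.\<close>

lemma tv2_le_grid_bound:
  assumes "grid_bounded f B" "sorted xs" "sorted ys"
  shows "tv2 f xs ys \<le> B"
proof -
  have B: "0 \<le> B"
    using grid_boundedD[OF assms(1), of 0 _ 0] by (simp add: grid_sum_def)
  show ?thesis
  proof (cases "xs = [] \<or> ys = []")
    case True
    then show ?thesis using B by (auto simp: tv2_Nil2)
  next
    case False
    define us where "us = remdups_adj xs"
    define vs where "vs = remdups_adj ys"
    have ne: "us \<noteq> []" "vs \<noteq> []" using False by (auto simp: us_def vs_def)
    have s: "sorted_wrt (<) us" "sorted_wrt (<) vs"
      unfolding us_def vs_def using assms strict_sorted_remdups_adj by auto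
    have "tv2 f xs ys = tv2 f us vs"
      by (simp add: us_def vs_def tv2_remdups_adj tv2_remdups_adj2)
    also have "\<dots> = grid_sum f ((!) us) (length us - 1) ((!) vs) (length vs - 1)"
      using tv2_map_upt[of f "(!) us" "length us - 1" "(!) vs" "length vs - 1"]
      by (simp only: list_map_nth[OF ne(1), symmetric] list_map_nth[OF ne(2), symmetric])
    also have "\<dots> \<le> B"
      by (rule grid_boundedD[OF assms(1)]; rule sorted_wrt_nth_less[OF s(1)] sorted_wrt_nth_less[OF s(2)]) auto
    finally show ?thesis .
  qed
qed

text \<open>The concatenation has all increments of both lists and at most one more, across the
  junction, which is nonnegative.\<close>

lemma tv2_append: "tv2 f xs ys + tv2 f zs ys \<le> tv2 f (xs @ zs) ys"
proof (induction xs)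
  case (Cons x xs)
  show ?case
  proof (cases xs)
    case Nil
    then show ?thesis by (cases zs) (auto simp: tv_nonneg)
  next
    case (Cons a list)
    then show ?thesis using Cons.IH by auto
  qed
qed auto

lemma tv2_le_foldr_insort: "tv2 f xs ys \<le> tv2 f xs (foldr insort zs ys)"
  by (induction zs) (auto intro: order_trans tv2_le_insort)

lemma mset_foldr_insort: "mset (foldr insort zs ys) = mset zs + mset ys"
  by (induction zs) auto

lemma sorted_foldr_insort: "sorted ys \<Longrightarrow> sorted (foldr insort zs ys)"
  by (induction zs) (auto simp: sorted_insort)

text \<open>Superadditivity over strips that carry different y-grids: both grids are first refined
  to their common merge.\<close>

lemma tv2_concat:
  assumes "sorted ys" "sorted ws"
  obtains vs where "sorted vs" "tv2 f xs ys + tv2 f zs ws \<le> tv2 f (xs @ zs) vs"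
proof
  show "sorted (foldr insort ys ws)" using assms by (simp add: sorted_foldr_insort)
  \<comment> \<open>Both merges are sorted lists with the same multiset of entries, hence equal; so
    one list refines \<open>ys\<close> and \<open>ws\<close> at the same time.\<close>
  have "foldr insort ys ws = foldr insort ws ys"
    using properties_for_sort[of "foldr insort ys ws" "foldr insort ws ys"]
      properties_for_sort[of "foldr insort ws ys" "foldr insort ws ys"] assms
      by (simp add: mset_foldr_insort sorted_foldr_insort)
  then have "tv2 f xs ys + tv2 f zs ws \<le> tv2 f xs (foldr insort ys ws) + tv2 f zs (foldr insort ys ws)"
    using tv2_le_foldr_insort[of f zs ws ys] tv2_le_foldr_insort[of f xs ys ws] by simp
  then show "tv2 f xs ys + tv2 f zs ws \<le> tv2 f (xs @ zs) (foldr insort ys ws)"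
    using tv2_append[of f xs "foldr insort ys ws" zs] by simp
qed

section \<open>Tails, continuity and summation by parts\<close>

text \<open>A grid whose variation comes within \<epsilon> of the supremum leaves at most \<epsilon>
  for anything placed beside it. The bound is uniform in \<open>ys\<close>.\<close>

lemma tv2_tail_small:
  assumes "grid_bounded f B" "\<epsilon> > 0"
  obtains M where "M > 0"
    "\<And>xs ys. \<lbrakk>sorted xs; sorted ys; set xs \<subseteq> {..-M} \<or> set xs \<subseteq> {M..}\<rbrakk> \<Longrightarrow> tv2 f xs ys \<le> \<epsilon>"
proof -
  define T where "T = {tv2 f xs ys |xs ys. sorted xs \<and> sorted ys}"
  have bdd: "bdd_above T"
    unfolding T_def using tv2_le_grid_bound[OF assms(1)] by (auto intro!: bdd_aboveI)
  have "tv2 f [] [] \<in> T" unfolding T_def by (intro CollectI exI conjI, rule refl) auto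
  then have "T \<noteq> {}" by auto
  then obtain t where "t \<in> T" "Sup T - \<epsilon> < t"
    using less_cSup_iff[OF _ bdd, of "Sup T - \<epsilon>"] assms(2) by auto
  then obtain ps qs where pq: "sorted ps" "sorted qs" "Sup T - \<epsilon> < tv2 f ps qs"
    unfolding T_def by auto
  \<comment> \<open>\<open>M\<close> exceeds the modulus of every abscissa of the near-optimal grid;
    the inserted 0 and the added 1 keep it positive even if \<open>ps\<close> is empty.\<close>
  define M where "M = 1 + Max (insert 0 (abs ` set ps))"
  have M: "\<bar>z\<bar> \<le> M" if "z \<in> set ps" for z
    unfolding M_def using that by (simp add: Max.coboundedI add_increasing)
  have M0: "M > 0" unfolding M_def
    by (smt (verit) Max_ge finite.insertI finite_imageI finite_set insertI1)
  have M': "- M \<le> z" "z \<le> M" if "z \<in> set ps" for z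
    using M[OF that] by auto
  show ?thesis
  proof (rule that[OF M0])
    fix xs ys :: "real list" assume s: "sorted xs" "sorted ys" and "set xs \<subseteq> {..-M} \<or> set xs \<subseteq> {M..}"
    then have "(\<forall>x\<in>set xs. x \<le> - M) \<or> (\<forall>x\<in>set xs. M \<le> x)"
      by auto
    \<comment> \<open>A list in one tail lies entirely on one side of \<open>ps\<close>, so the
      concatenation in the right order is again sorted.\<close>
    then have "sorted (xs @ ps) \<or> sorted (ps @ xs)"
      using s(1) pq(1) M' by (fastforce simp: sorted_append)
    then have "tv2 f xs ys + tv2 f ps qs \<le> Sup T"
    proof
      assume *: "sorted (xs @ ps)"
      obtain vs where "sorted vs" "tv2 f xs ys + tv2 f ps qs \<le> tv2 f (xs @ ps) vs"
        using tv2_concat[OF s(2) pq(2)] by blast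
      moreover have "tv2 f (xs @ ps) vs \<le> Sup T"
        using * \<open>sorted vs\<close> by (intro cSup_upper[OF _ bdd]) (auto simp: T_def)
      ultimately show ?thesis by simp
    next
      assume *: "sorted (ps @ xs)"
      obtain vs where "sorted vs" "tv2 f ps qs + tv2 f xs ys \<le> tv2 f (ps @ xs) vs"
        using tv2_concat[OF pq(2) s(2)] by blast
      moreover have "tv2 f (ps @ xs) vs \<le> Sup T"
        using * \<open>sorted vs\<close> by (intro cSup_upper[OF _ bdd]) (auto simp: T_def)
      ultimately show ?thesis by simp
    qed
    then show "tv2 f xs ys \<le> \<epsilon>" using pq(3) by simp
  qed
qed

lemma tendsto_at_infinity_shift:
  fixes f :: "real \<times> real \<Rightarrow> real"
  assumes "(f \<longlongrightarrow> 0) at_infinity"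
  shows "((\<lambda>L. f (x, L)) \<longlongrightarrow> 0) at_top" "((\<lambda>L. f (x, - L)) \<longlongrightarrow> 0) at_top"
    "((\<lambda>L. f (L, x)) \<longlongrightarrow> 0) at_top" "((\<lambda>L. f (- L, x)) \<longlongrightarrow> 0) at_top"
    "((\<lambda>L. f (L, L)) \<longlongrightarrow> 0) at_top" "((\<lambda>L. f (L, - L)) \<longlongrightarrow> 0) at_top"
    "((\<lambda>L. f (- L, L)) \<longlongrightarrow> 0) at_top" "((\<lambda>L. f (- L, - L)) \<longlongrightarrow> 0) at_top"
proof -
  have *: "((\<lambda>L. f (g L)) \<longlongrightarrow> 0) at_top" if "\<And>L. \<bar>L\<bar> \<le> norm (g L)" for g :: "real \<Rightarrow> real \<times> real"
  proof (rule filterlim_compose[OF assms])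
    have "filterlim (\<lambda>L. norm (g L)) at_top at_top"
      by (rule filterlim_at_top_mono[OF filterlim_ident])
        (use that in \<open>auto intro!: always_eventually intro: order_trans[OF abs_ge_self]\<close>)
    then show "filterlim g at_infinity at_top"
      by (rule filterlim_norm_at_top_imp_at_infinity)
  qed
  have n: "\<bar>a\<bar> \<le> norm (a, b)" "\<bar>b\<bar> \<le> norm (a, b)" for a b :: real
    using norm_fst_le[of a b] norm_snd_le[of b a] by auto
  show "((\<lambda>L. f (x, L)) \<longlongrightarrow> 0) at_top" "((\<lambda>L. f (x, - L)) \<longlongrightarrow> 0) at_top"
    "((\<lambda>L. f (L, x)) \<longlongrightarrow> 0) at_top" "((\<lambda>L. f (- L, x)) \<longlongrightarrow> 0) at_top"
    "((\<lambda>L. f (L, L)) \<longlongrightarrow> 0) at_top" "((\<lambda>L. f (L, - L)) \<longlongrightarrow> 0) at_top"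
    "((\<lambda>L. f (- L, L)) \<longlongrightarrow> 0) at_top" "((\<lambda>L. f (- L, - L)) \<longlongrightarrow> 0) at_top"
    using n by (auto intro!: * simp: n(1)[where a = "- a" for a, simplified]
        n(2)[where b = "- b" for b, simplified])
qed

section \<open>Boundedness, and continuity off countably many lines\<close>

text \<open>The mixed difference over a rectangle with upper right corner \<open>(x, y)\<close>
  tends to \<open>f (x, y)\<close> when the opposite corner recedes to infinity, since the other
  three values vanish in the limit.\<close>

lemma abs_le_grid_bound:
  assumes "grid_bounded f B" "(f \<longlongrightarrow> 0) at_infinity"
  shows "\<bar>f (x, y)\<bar> \<le> B"
proof -
  note lims = tendsto_at_infinity_shift[OF assms(2)]
  have "((\<lambda>L. tv2 f [-L, x] [-L, y]) \<longlongrightarrow> \<bar>(f (x, y) - 0) - (0 - 0)\<bar> + 0 + 0) at_top"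
    unfolding tv2.simps tv.simps
    by (intro tendsto_intros lims)
  moreover have "eventually (\<lambda>L. tv2 f [-L, x] [-L, y] \<le> B) at_top"
    using eventually_ge_at_top[of "-x"] eventually_ge_at_top[of "-y"]
    by eventually_elim (rule tv2_le_grid_bound[OF assms(1)], auto)
  ultimately show ?thesis
    using tendsto_upperbound by fastforce
qed

text \<open>The variation over the half-plane to the left of \<open>x\<close>: for the functions
  considered here it is monotone, and its jumps mark the vertical lines on which \<open>f\<close>
  may be discontinuous.\<close>

definition left_variation :: "(real \<times> real \<Rightarrow> real) \<Rightarrow> real \<Rightarrow> real" where
  "left_variation f x = Sup {tv2 f xs ys |xs ys. sorted xs \<and> sorted ys \<and> set xs \<subseteq> {..x}}"

text \<open>Every grid to the left of \<open>a\<close> can be prolonged by the strip from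
  \<open>a\<close> to \<open>b\<close>. The mixed difference over this strip, between the height
  \<open>y\<close> and a height tending to minus infinity, tends to the left-hand side.\<close>

lemma abs_diff_le_left_variation:
  assumes "grid_bounded f B" "(f \<longlongrightarrow> 0) at_infinity" and ab: "a \<le> b"
  shows "\<bar>f (b, y) - f (a, y)\<bar> \<le> left_variation f b - left_variation f a"
proof -
  define T where "T x = {tv2 f xs ys |xs ys. sorted xs \<and> sorted ys \<and> set xs \<subseteq> {..x}}" for x
  have bdd: "bdd_above (T x)" for x
    unfolding T_def using tv2_le_grid_bound[OF assms(1)] by (auto intro!: bdd_aboveI)
  have ne: "T x \<noteq> {}" for x
  proof -
    have "tv2 f [] [] \<in> T x" unfolding T_def by (intro CollectI exI conjI, rule refl) auto
    then show ?thesis by auto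
  qed
  note lims = tendsto_at_infinity_shift[OF assms(2)]
  have "Sup (T a) \<le> Sup (T b) - \<bar>f (b, y) - f (a, y)\<bar>"
  proof (rule cSup_least[OF ne])
    fix t assume "t \<in> T a"
    then obtain xs ys where xy: "t = tv2 f xs ys" "sorted xs" "sorted ys" "set xs \<subseteq> {..a}"
      unfolding T_def by auto
    have ev: "eventually (\<lambda>L. t + tv2 f [a, b] [-L, y] \<le> Sup (T b)) at_top"
      using eventually_ge_at_top[of "-y"]
    proof eventually_elim
      case (elim L)
      then have "sorted [-L, y]" by simp
      then obtain vs where vs: "sorted vs" "tv2 f xs ys + tv2 f [a, b] [-L, y] \<le> tv2 f (xs @ [a, b]) vs"
        using tv2_concat[OF xy(3)] by blast
      have "sorted (xs @ [a, b])" "set (xs @ [a, b]) \<subseteq> {..b}"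
        using xy ab by (auto simp: sorted_append)
      then have "tv2 f (xs @ [a, b]) vs \<in> T b" unfolding T_def using vs(1) by blast
      then show ?case using vs(2) xy(1) cSup_upper[OF _ bdd] by (smt (verit))
    qed
    have "((\<lambda>L. t + tv2 f [a, b] [-L, y]) \<longlongrightarrow> t + (\<bar>(f (b, y) - f (a, y)) - (0 - 0)\<bar> + 0 + 0)) at_top"
      unfolding tv2.simps tv.simps by (intro tendsto_intros lims)
    from tendsto_upperbound[OF this ev] show "t \<le> Sup (T b) - \<bar>f (b, y) - f (a, y)\<bar>" by simp
  qed
  then show ?thesis by (simp add: left_variation_def T_def)
qed

text \<open>A monotone function has only countably many discontinuities. As
  \<open>left_variation\<close> does not depend on \<open>y\<close>, one \<delta> serves all
  \<open>y\<close> at once.\<close>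

lemma equicontinuous_off_countable:
  assumes "grid_bounded f B" "(f \<longlongrightarrow> 0) at_infinity"
  obtains C where "countable C"
    "\<And>x \<epsilon>. \<lbrakk>x \<notin> C; \<epsilon> > 0\<rbrakk> \<Longrightarrow> \<exists>\<delta>>0. \<forall>x' y. \<bar>x' - x\<bar> < \<delta> \<longrightarrow> \<bar>f (x', y) - f (x, y)\<bar> < \<epsilon>"
proof
  note le = abs_diff_le_left_variation[OF assms]
  have "mono (left_variation f)"
    by (rule monoI) (use le in \<open>force\<close>)
  then show "countable {x. \<not> isCont (left_variation f) x}"
    by (rule mono_ctble_discont)
  fix x and \<epsilon> :: real assume "x \<notin> {x. \<not> isCont (left_variation f) x}" "\<epsilon> > 0"
  then obtain \<delta> where d: "\<delta> > 0"
    "\<And>x'. \<bar>x' - x\<bar> < \<delta> \<Longrightarrow> \<bar>left_variation f x' - left_variation f x\<bar> < \<epsilon>"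
    unfolding continuous_at_eps_delta dist_real_def by auto
  show "\<exists>\<delta>>0. \<forall>x' y. \<bar>x' - x\<bar> < \<delta> \<longrightarrow> \<bar>f (x', y) - f (x, y)\<bar> < \<epsilon>"
  proof (intro exI[of _ \<delta>] conjI d allI impI)
    fix x' y assume "\<bar>x' - x\<bar> < \<delta>"
    from d(2)[OF this] show "\<bar>f (x', y) - f (x, y)\<bar> < \<epsilon>"
      using le[of x x' y] le[of x' x y] by (cases "x \<le> x'") auto
  qed
qed

lemma isCont_off_countable_lines:
  assumes "grid_bounded f B" "(f \<longlongrightarrow> 0) at_infinity"
  obtains C D where "countable C" "countable D"
    "\<And>x y. \<lbrakk>x \<notin> C; y \<notin> D\<rbrakk> \<Longrightarrow> isCont f (x, y)"
proof -
  obtain C where C: "countable C"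
    "\<And>x \<epsilon>. \<lbrakk>x \<notin> C; \<epsilon> > 0\<rbrakk> \<Longrightarrow> \<exists>\<delta>>0. \<forall>x' y. \<bar>x' - x\<bar> < \<delta> \<longrightarrow> \<bar>f (x', y) - f (x, y)\<bar> < \<epsilon>"
    using equicontinuous_off_countable[OF assms] by blast
  obtain D where D: "countable D"
    "\<And>y \<epsilon>. \<lbrakk>y \<notin> D; \<epsilon> > 0\<rbrakk> \<Longrightarrow> \<exists>\<delta>>0. \<forall>y' x. \<bar>y' - y\<bar> < \<delta> \<longrightarrow> \<bar>f (x, y') - f (x, y)\<bar> < \<epsilon>"
    using equicontinuous_off_countable[OF grid_bounded_swap[OF assms(1)] tendsto_swap_at_infinity[OF assms(2)]]
    by (auto simp: o_def)
  show ?thesis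
  proof (rule that[OF C(1) D(1)])
    fix x y assume "x \<notin> C" "y \<notin> D"
    show "isCont f (x, y)"
      unfolding continuous_at_eps_delta
    proof (intro allI impI)
      fix e :: real assume "e > 0"
      then have "e / 2 > 0" by simp
      obtain d1 where d1: "d1 > 0" "\<And>x' y. \<bar>x' - x\<bar> < d1 \<Longrightarrow> \<bar>f (x', y) - f (x, y)\<bar> < e / 2"
        using C(2)[OF \<open>x \<notin> C\<close> \<open>e / 2 > 0\<close>] by blast
      obtain d2 where d2: "d2 > 0" "\<And>y' x. \<bar>y' - y\<bar> < d2 \<Longrightarrow> \<bar>f (x, y') - f (x, y)\<bar> < e / 2"
        using D(2)[OF \<open>y \<notin> D\<close> \<open>e / 2 > 0\<close>] by blast
      show "\<exists>d>0. \<forall>x'. dist x' (x, y) < d \<longrightarrow> dist (f x') (f (x, y)) < e"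
      proof (intro exI[of _ "min d1 d2"] conjI allI impI)
        fix z :: "real \<times> real" assume z: "dist z (x, y) < min d1 d2"
        obtain x' y' where [simp]: "z = (x', y')" by (cases z)
        have "\<bar>x' - x\<bar> < d1" "\<bar>y' - y\<bar> < d2"
          using z dist_fst_le[of z "(x, y)"] dist_snd_le[of z "(x, y)"] by (auto simp: dist_real_def)
        \<comment> \<open>The intermediate point is \<open>(x, y')\<close>: the modulus at
          \<open>x\<close> is applied on the moving line of height \<open>y'\<close>, which is where
          its uniformity matters.\<close>
        have "\<bar>f (x', y') - f (x, y)\<bar> < e"
          using d1(2)[of x' y'] d2(2)[of y' x] \<open>\<bar>x' - x\<bar> < d1\<close> \<open>\<bar>y' - y\<bar> < d2\<close> by linarith
        then show "dist (f z) (f (x, y)) < e" by (simp add: dist_real_def)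
      qed (use d1 d2 in auto)
    qed
  qed
qed

text \<open>Sampling \<open>f\<close> at the left endpoints of the \<open>n \<times> m\<close> cells given by \<open>x 0, \<dots>, x n\<close> and
  \<open>y 0, \<dots>, y m\<close>; the index is shifted by one so that the frame of zeros carries the
  values of \<open>f\<close> at infinity.\<close>

definition zero_pad :: "(real \<times> real \<Rightarrow> real) \<Rightarrow> (nat \<Rightarrow> real) \<Rightarrow> nat \<Rightarrow> (nat \<Rightarrow> real) \<Rightarrow> nat \<Rightarrow> nat \<Rightarrow> nat \<Rightarrow> real" where
  "zero_pad f x n y m i j = (if i \<in> {1..n} \<and> j \<in> {1..m} then f (x (i - 1), y (j - 1)) else 0)"

definition pad_diff :: "(real \<times> real \<Rightarrow> real) \<Rightarrow> (nat \<Rightarrow> real) \<Rightarrow> nat \<Rightarrow> (nat \<Rightarrow> real) \<Rightarrow> nat \<Rightarrow> nat \<Rightarrow> nat \<Rightarrow> real" where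
  "pad_diff f x n y m i j =
     zero_pad f x n y m (Suc i) (Suc j) - zero_pad f x n y m i (Suc j)
     - zero_pad f x n y m (Suc i) j + zero_pad f x n y m i j"

text \<open>Indices 1 to \<open>n\<close> hold the sample points, flanked by \<open>- L\<close> and
  \<open>L\<close>. On such grids the values of \<open>f\<close> tend to \<open>zero_pad\<close> as
  \<open>L\<close> grows, so padded differences are limits of genuine ones.\<close>

definition pad_points :: "(nat \<Rightarrow> real) \<Rightarrow> nat \<Rightarrow> real \<Rightarrow> nat \<Rightarrow> real" where
  "pad_points x n L i = (if i = 0 then - L else if i \<le> n then x (i - 1) else L)"

lemma tendsto_pad_points:
  assumes "(f \<longlongrightarrow> 0) at_infinity"
  shows "((\<lambda>L. f (pad_points x n L i, pad_points y m L j)) \<longlongrightarrow> zero_pad f x n y m i j) at_top"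
  unfolding pad_points_def zero_pad_def
  by (cases "i = 0"; cases "i \<le> n"; cases "j = 0"; cases "j \<le> m")
    (auto simp: tendsto_at_infinity_shift[OF assms])

lemma tendsto_Delta_pad_points:
  assumes "(f \<longlongrightarrow> 0) at_infinity"
  shows "((\<lambda>L. Delta f (pad_points x n L i) (pad_points x n L (Suc i))
      (pad_points y m L j) (pad_points y m L (Suc j))) \<longlongrightarrow> pad_diff f x n y m i j) at_top"
  unfolding Delta_def pad_diff_def
  by (intro tendsto_intros tendsto_pad_points assms)

lemma eventually_pad_points_less:
  assumes "\<forall>i<n. x i < x (Suc i)"
  shows "eventually (\<lambda>L. \<forall>i\<le>n. pad_points x n L i < pad_points x n L (Suc i)) at_top"
  using eventually_gt_at_top[of "- x 0"] eventually_gt_at_top[of "x n"] eventually_gt_at_top[of 0]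
proof eventually_elim
  case (elim L)
  show ?case
  proof (intro allI impI)
    fix i assume "i \<le> n"
    have "x (i - 1) \<le> x n" by (rule increasing_chain_mono[OF assms]) (use \<open>i \<le> n\<close> in auto)
    moreover have "x (i - 1) < x i" if "i > 0" using assms[rule_format, of "i - 1"] that \<open>i \<le> n\<close> by auto
    ultimately show "pad_points x n L i < pad_points x n L (Suc i)"
      using elim \<open>i \<le> n\<close> unfolding pad_points_def by auto
  qed
qed

text \<open>The left-hand side is a limit of grid sums of \<open>f\<close> itself, over grids whose
  outer points recede to infinity; the frame of zeros therefore costs no extra variation.\<close>

lemma pad_diff_sum_le:
  assumes "grid_bounded f B" "(f \<longlongrightarrow> 0) at_infinity"
    and "\<forall>i<n. x i < x (Suc i)" "\<forall>j<m. y j < y (Suc j)"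
  shows "(\<Sum>i\<le>n. \<Sum>j\<le>m. \<bar>pad_diff f x n y m i j\<bar>) \<le> B"
proof (rule tendsto_upperbound)
  show "((\<lambda>L. grid_sum f (pad_points x n L) (Suc n) (pad_points y m L) (Suc m)) \<longlongrightarrow>
      (\<Sum>i\<le>n. \<Sum>j\<le>m. \<bar>pad_diff f x n y m i j\<bar>)) at_top"
    unfolding grid_sum_def lessThan_Suc_atMost
    by (intro tendsto_sum tendsto_rabs tendsto_Delta_pad_points assms)
  show "\<forall>\<^sub>F L in at_top. grid_sum f (pad_points x n L) (Suc n) (pad_points y m L) (Suc m) \<le> B"
    using eventually_pad_points_less[OF assms(3)] eventually_pad_points_less[OF assms(4)]
    by eventually_elim (auto intro!: grid_boundedD[OF assms(1)])
qed simp

text \<open>The sampling points all lie in one tail, so that the first and the last column, where the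
  zero frame meets the sample, are themselves limits of tail variations.\<close>

lemma pad_diff_sum_tail_le:
  assumes f: "(f \<longlongrightarrow> 0) at_infinity" and "M > 0"
    and tail: "\<And>xs ys. \<lbrakk>sorted xs; sorted ys; set xs \<subseteq> {..-M} \<or> set xs \<subseteq> {M..}\<rbrakk> \<Longrightarrow> tv2 f xs ys \<le> \<epsilon>"
    and x: "\<forall>i<n. x i < x (Suc i)" and y: "\<forall>j<m. y j < y (Suc j)"
    and xM: "x n \<le> - M \<or> M \<le> x 0"
  shows "(\<Sum>i\<le>n. \<Sum>j\<le>m. \<bar>pad_diff f x n y m i j\<bar>) \<le> 3 * \<epsilon>"
proof -
  note lims = tendsto_at_infinity_shift[OF f]
  let ?z = "zero_pad f x n y m"
  have e0: "0 \<le> \<epsilon>" using tail[of "[]" "[]"] by simp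
  have xs: "(\<forall>i\<le>n. x i \<le> - M) \<or> (\<forall>i\<le>n. M \<le> x i)"
    using xM increasing_chain_mono[of n x 0] increasing_chain_mono[of n x _ n] x
    by (meson le0 order_trans le_refl)
  have ys: "\<forall>\<^sub>F L in at_top. sorted (map (pad_points y m L) [0..<Suc (Suc m)])"
    using eventually_pad_points_less[OF y]
  proof eventually_elim
    case (elim L)
    have "pad_points y m L i \<le> pad_points y m L j" if "i \<le> j" "j < Suc (Suc m)" for i j
      by (rule increasing_chain_mono[of "Suc m"]) (use elim that in auto)
    then show ?case by (auto simp: sorted_iff_nth_mono simp del: upt_Suc)
  qed
  have t: "((\<lambda>L. f (x (i - 1), pad_points y m L j)) \<longlongrightarrow> ?z i j) at_top" if "1 \<le> i" "i \<le> n" for i j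
    using tendsto_pad_points[OF f, of x n i y m j] that by (simp add: pad_points_def[of x n])
  \<comment> \<open>In the left tail a strip from \<open>- L\<close> to the sample column stays in
    that tail, in the right tail a strip from the column to \<open>L\<close>. On the receding line
    \<open>f\<close> tends to 0, and only the increments along the column remain.\<close>
  have col: "(\<Sum>j\<le>m. \<bar>?z i (Suc j) - ?z i j\<bar>) \<le> \<epsilon>" if "1 \<le> i" "i \<le> n" for i
  proof (cases "\<forall>i\<le>n. x i \<le> - M")
    case True
    show ?thesis
    proof (rule tendsto_upperbound)
      let ?p = "\<lambda>L k. if k = (0::nat) then - L else x (i - 1)"
      have l: "((\<lambda>L. f (- L, pad_points y m L j)) \<longlongrightarrow> 0) at_top" for j
        unfolding pad_points_def using lims by (cases "j = 0"; cases "j \<le> m") simp_all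
      have eq: "grid_sum f (?p L) 1 (pad_points y m L) (Suc m) = (\<Sum>j\<le>m. \<bar>f (x (i - 1), pad_points y m L (Suc j)) - f (- L, pad_points y m L (Suc j)) - f (x (i - 1), pad_points y m L j) + f (- L, pad_points y m L j)\<bar>)" for L
        by (simp add: grid_sum_def Delta_def lessThan_Suc_atMost)
      have "((\<lambda>L. grid_sum f (?p L) 1 (pad_points y m L) (Suc m)) \<longlongrightarrow>
          (\<Sum>j\<le>m. \<bar>?z i (Suc j) - 0 - ?z i j + 0\<bar>)) at_top"
        unfolding eq by (intro tendsto_intros t[OF that] l)
      then show "((\<lambda>L. tv2 f [- L, x (i - 1)] (map (pad_points y m L) [0..<Suc (Suc m)])) \<longlongrightarrow>
          (\<Sum>j\<le>m. \<bar>?z i (Suc j) - ?z i j\<bar>)) at_top"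
        unfolding tv2_map_upt[symmetric] by simp
      show "\<forall>\<^sub>F L in at_top. tv2 f [- L, x (i - 1)] (map (pad_points y m L) [0..<Suc (Suc m)]) \<le> \<epsilon>"
        using ys eventually_ge_at_top[of M] eventually_ge_at_top[of "- x (i - 1)"]
        by eventually_elim (use True that in \<open>auto intro!: tail simp del: upt_Suc tv2.simps\<close>)
    qed simp
  next
    case False
    then have F: "\<forall>i\<le>n. M \<le> x i" using xs by blast
    show ?thesis
    proof (rule tendsto_upperbound)
      let ?p = "\<lambda>L k. if k = (0::nat) then x (i - 1) else L"
      have l: "((\<lambda>L. f (L, pad_points y m L j)) \<longlongrightarrow> 0) at_top" for j
        unfolding pad_points_def using lims by (cases "j = 0"; cases "j \<le> m") simp_all
      have eq: "grid_sum f (?p L) 1 (pad_points y m L) (Suc m) = (\<Sum>j\<le>m. \<bar>f (L, pad_points y m L (Suc j)) - f (x (i - 1), pad_points y m L (Suc j)) - f (L, pad_points y m L j) + f (x (i - 1), pad_points y m L j)\<bar>)" for L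
        by (simp add: grid_sum_def Delta_def lessThan_Suc_atMost)
      have "((\<lambda>L. grid_sum f (?p L) 1 (pad_points y m L) (Suc m)) \<longlongrightarrow>
          (\<Sum>j\<le>m. \<bar>0 - ?z i (Suc j) - 0 + ?z i j\<bar>)) at_top"
        unfolding eq by (intro tendsto_intros t[OF that] l)
      moreover have "\<bar>0 - ?z i (Suc j) - 0 + ?z i j\<bar> = \<bar>?z i (Suc j) - ?z i j\<bar>" for j by simp
      ultimately show "((\<lambda>L. tv2 f [x (i - 1), L] (map (pad_points y m L) [0..<Suc (Suc m)])) \<longlongrightarrow>
          (\<Sum>j\<le>m. \<bar>?z i (Suc j) - ?z i j\<bar>)) at_top"
        unfolding tv2_map_upt[symmetric] by simp
      show "\<forall>\<^sub>F L in at_top. tv2 f [x (i - 1), L] (map (pad_points y m L) [0..<Suc (Suc m)]) \<le> \<epsilon>"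
        using ys eventually_ge_at_top[of M] eventually_ge_at_top[of "x (i - 1)"]
        by eventually_elim (use F that in \<open>auto intro!: tail simp del: upt_Suc tv2.simps\<close>)
    qed simp
  qed
  show ?thesis
  proof (cases "n = 0")
    case True
    then show ?thesis using e0 by (simp add: pad_diff_def zero_pad_def)
  next
    case False
    have mid: "(\<Sum>i<n - 1. \<Sum>j\<le>m. \<bar>pad_diff f x n y m (Suc i) j\<bar>) \<le> \<epsilon>"
    proof (rule tendsto_upperbound)
      have eq: "grid_sum f x (n - 1) (pad_points y m L) (Suc m) =
          (\<Sum>i<n - 1. \<Sum>j\<le>m. \<bar>Delta f (pad_points x n L (Suc i)) (pad_points x n L (Suc (Suc i)))
          (pad_points y m L j) (pad_points y m L (Suc j))\<bar>)" for L
        unfolding grid_sum_def lessThan_Suc_atMost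
        by (intro sum.cong refl) (auto simp: pad_points_def[of x n])
      have "((\<lambda>L. \<Sum>i<n - 1. \<Sum>j\<le>m. \<bar>Delta f (pad_points x n L (Suc i)) (pad_points x n L (Suc (Suc i)))
          (pad_points y m L j) (pad_points y m L (Suc j))\<bar>) \<longlongrightarrow>
          (\<Sum>i<n - 1. \<Sum>j\<le>m. \<bar>pad_diff f x n y m (Suc i) j\<bar>)) at_top"
        by (intro tendsto_sum tendsto_rabs tendsto_Delta_pad_points f)
      then show "((\<lambda>L. tv2 f (map x [0..<Suc (n - 1)]) (map (pad_points y m L) [0..<Suc (Suc m)])) \<longlongrightarrow>
          (\<Sum>i<n - 1. \<Sum>j\<le>m. \<bar>pad_diff f x n y m (Suc i) j\<bar>)) at_top"
        unfolding tv2_map_upt eq .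
      have "x i \<le> x j" if "i \<le> j" "j < n" for i j
        by (rule increasing_chain_mono[of n x]) (use that x in auto)
      then have "sorted (map x [0..<Suc (n - 1)])"
        using False by (auto simp: sorted_iff_nth_mono simp del: upt_Suc)
      moreover have "set (map x [0..<Suc (n - 1)]) \<subseteq> {..-M} \<or> set (map x [0..<Suc (n - 1)]) \<subseteq> {M..}"
        using xs False by (auto simp del: upt_Suc)
      ultimately have "tv2 f (map x [0..<Suc (n - 1)]) zs \<le> \<epsilon>" if "sorted zs" for zs
        using tail that by blast
      then show "\<forall>\<^sub>F L in at_top. tv2 f (map x [0..<Suc (n - 1)]) (map (pad_points y m L) [0..<Suc (Suc m)]) \<le> \<epsilon>"
        using ys by (rule eventually_mono[rotated])
    qed simp
    have "pad_diff f x n y m 0 j = ?z 1 (Suc j) - ?z 1 j"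
      "\<bar>pad_diff f x n y m n j\<bar> = \<bar>?z n (Suc j) - ?z n j\<bar>" for j
      by (auto simp: pad_diff_def zero_pad_def abs_minus_commute)
    then have "(\<Sum>j\<le>m. \<bar>pad_diff f x n y m 0 j\<bar>) \<le> \<epsilon>" "(\<Sum>j\<le>m. \<bar>pad_diff f x n y m n j\<bar>) \<le> \<epsilon>"
      using col[of 1] col[of n] False by auto
    \<comment> \<open>One \<epsilon> each for the first column, the interior and the last column:
      this is the factor 3.\<close>
    moreover have "(\<Sum>i\<le>n. \<Sum>j\<le>m. \<bar>pad_diff f x n y m i j\<bar>) =
        (\<Sum>j\<le>m. \<bar>pad_diff f x n y m 0 j\<bar>) + (\<Sum>i<n - 1. \<Sum>j\<le>m. \<bar>pad_diff f x n y m (Suc i) j\<bar>)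
        + (\<Sum>j\<le>m. \<bar>pad_diff f x n y m n j\<bar>)"
    proof -
      obtain k where "n = Suc k" using False by (cases n) auto
      have "(\<Sum>i\<le>Suc k. g i) = g 0 + (\<Sum>i<k. g (Suc i)) + g (Suc k)" for g :: "nat \<Rightarrow> real"
        using sum.lessThan_Suc_shift[of g k] by (simp add: lessThan_Suc_atMost[symmetric])
      then show ?thesis using \<open>n = Suc k\<close> by simp
    qed
    ultimately show ?thesis using mid by linarith
  qed
qed

lemma pad_diff_swap: "pad_diff (f \<circ> prod.swap) y m x n j i = pad_diff f x n y m i j"
  by (auto simp: pad_diff_def zero_pad_def)

section \<open>Summation by parts\<close>

text \<open>Abel summation; the zeros at both ends of \<open>h\<close> remove the boundary terms,
  whatever constant of integration \<open>K\<close> carries.\<close>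

lemma summation_by_parts_padded:
  fixes h K :: "nat \<Rightarrow> 'a :: comm_ring"
  assumes "h 0 = 0" "h (Suc n) = 0"
  shows "(\<Sum>i<n. h (Suc i) * (K (Suc i) - K i)) = - (\<Sum>i\<le>n. (h (Suc i) - h i) * K i)"
proof -
  have 1: "(\<Sum>i\<le>n. h i * K i) = (\<Sum>i<n. h (Suc i) * K (Suc i))"
    using assms(1) by (simp add: sum.atMost_shift)
  have 2: "(\<Sum>i\<le>n. h (Suc i) * K i) = (\<Sum>i<n. h (Suc i) * K i)"
    using assms(2) by (simp add: lessThan_Suc_atMost[symmetric])
  have "(\<Sum>i<n. h (Suc i) * (K (Suc i) - K i)) = (\<Sum>i\<le>n. h i * K i) - (\<Sum>i\<le>n. h (Suc i) * K i)"
    unfolding 1 2 by (simp add: right_diff_distrib sum_subtractf)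
  then show ?thesis by (simp add: left_diff_distrib sum_subtractf)
qed

lemma summation_by_parts_2d:
  fixes K L :: "real \<Rightarrow> complex"
  shows "(\<Sum>i<n. \<Sum>j<m. complex_of_real (f (x i, y j)) * ((K (x (Suc i)) - K (x i)) * (L (y (Suc j)) - L (y j))))
    = (\<Sum>i\<le>n. \<Sum>j\<le>m. complex_of_real (pad_diff f x n y m i j) * (K (x i) * L (y j)))"
proof -
  let ?z = "\<lambda>i j. complex_of_real (zero_pad f x n y m i j)"
  have z: "?z i 0 = 0" "?z i (Suc m) = 0" "?z 0 j = 0" "?z (Suc n) j = 0" for i j
    by (auto simp: zero_pad_def)
  \<comment> \<open>\<open>H i\<close> is, up to sign, what the y-summation leaves in column
    \<open>i\<close>. It vanishes at 0 and at \<open>Suc n\<close> because the frame does, so a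
    second Abel summation applies, and the two minus signs cancel.\<close>
  define H where "H i = (\<Sum>j\<le>m. (?z i (Suc j) - ?z i j) * L (y j))" for i
  have inner: "(\<Sum>j<m. ?z i (Suc j) * (L (y (Suc j)) - L (y j))) = - H i" for i
    unfolding H_def by (rule summation_by_parts_padded[where h = "?z i" and K = "\<lambda>j. L (y j)"]) (auto simp: z)
  have "(\<Sum>i<n. \<Sum>j<m. complex_of_real (f (x i, y j)) * ((K (x (Suc i)) - K (x i)) * (L (y (Suc j)) - L (y j))))
      = (\<Sum>i<n. (\<Sum>j<m. ?z (Suc i) (Suc j) * (L (y (Suc j)) - L (y j))) * (K (x (Suc i)) - K (x i)))"
    unfolding sum_distrib_right by (intro sum.cong refl) (simp add: zero_pad_def mult_ac)
  also have "\<dots> = - (\<Sum>i<n. H (Suc i) * (K (x (Suc i)) - K (x i)))"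
    unfolding inner by (simp add: sum_negf)
  also have "\<dots> = (\<Sum>i\<le>n. (H (Suc i) - H i) * K (x i))"
    using summation_by_parts_padded[where h = H and K = "\<lambda>i. K (x i)" and n = n]
    by (simp add: H_def z)
  also have "\<dots> = (\<Sum>i\<le>n. \<Sum>j\<le>m. complex_of_real (pad_diff f x n y m i j) * (K (x i) * L (y j)))"
    unfolding H_def pad_diff_def sum_subtractf[symmetric] sum_distrib_right
    by (intro sum.cong refl) (simp add: algebra_simps)
  finally show ?thesis .
qed

section \<open>Integrals over rectangles as limits of padded sums\<close>

lemma negligible_countable_Times_UNIV:
  assumes "countable (C :: real set)"
  shows "negligible (C \<times> (UNIV :: real set))" "negligible ((UNIV :: real set) \<times> C)"
proof -
  have "{c} \<times> (UNIV :: real set) = {z. (1, 0) \<bullet> z = c}" "(UNIV :: real set) \<times> {c} = {z. (0, 1) \<bullet> z = c}" for c :: real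
    by auto
  then have n: "negligible ({c} \<times> (UNIV :: real set))" "negligible ((UNIV :: real set) \<times> {c})" for c :: real
    by (auto intro!: negligible_hyperplane simp: zero_prod_def)
  have "C \<times> (UNIV :: real set) = (\<Union>c\<in>C. {c} \<times> UNIV)" "(UNIV :: real set) \<times> C = (\<Union>c\<in>C. UNIV \<times> {c})"
    by auto
  then show "negligible (C \<times> (UNIV :: real set))" "negligible ((UNIV :: real set) \<times> C)"
    using n assms by (auto intro!: negligible_countable_Union)
qed

lemma has_integral_product_cbox:
  fixes k l :: "real \<Rightarrow> complex"
  assumes "continuous_on {a..b} k" "continuous_on {c..d} l"
  shows "((\<lambda>z. k (fst z) * l (snd z)) has_integral (integral {a..b} k * integral {c..d} l)) ({a..b} \<times> {c..d})"
proof -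
  have "continuous_on (cbox (a, c) (b, d)) (\<lambda>z. k (fst z) * l (snd z))"
    by (intro continuous_intros continuous_on_compose2[OF assms(1)] continuous_on_compose2[OF assms(2)])
      (auto simp: cbox_Pair_eq)
  from integrable_integral[OF integrable_continuous[OF this]] integral_prod_continuous[OF this]
  show ?thesis by (simp add: cbox_Pair_eq)
qed

text \<open>Fubini for continuous products reduces to one variable, where the fundamental theorem
  applies. The kernels become the increments that summation by parts expects.\<close>

lemma has_integral_product_antiderivatives:
  fixes k l K L :: "real \<Rightarrow> complex"
  assumes "\<And>t. (K has_vector_derivative k t) (at t)" "\<And>t. (L has_vector_derivative l t) (at t)"
    and "continuous_on UNIV k" "continuous_on UNIV l" "a \<le> b" "c \<le> d"
  shows "((\<lambda>z. k (fst z) * l (snd z)) has_integral ((K b - K a) * (L d - L c))) ({a..b} \<times> {c..d})"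
proof -
  have "(k has_integral (K b - K a)) {a..b}"
    by (rule fundamental_theorem_of_calculus[OF assms(5)]) (rule has_vector_derivative_at_within[OF assms(1)])
  moreover have "(l has_integral (L d - L c)) {c..d}"
    by (rule fundamental_theorem_of_calculus[OF assms(6)]) (rule has_vector_derivative_at_within[OF assms(2)])
  moreover have "continuous_on {a..b} k" "continuous_on {c..d} l"
    using assms(3,4) continuous_on_subset by blast+
  ultimately show ?thesis
    using has_integral_product_cbox[of a b k c d l] by (simp add: integral_unique)
qed

section \<open>Step functions sampling \<open>f\<close>\<close>

text \<open>On increasing grids the half-open cells are disjoint, so at most one summand survives;
  the value is 0 on the right and upper edges, a null set.\<close>

definition step_sample :: "(real \<times> real \<Rightarrow> real) \<Rightarrow> (nat \<Rightarrow> real) \<Rightarrow> nat \<Rightarrow> (nat \<Rightarrow> real) \<Rightarrow> nat \<Rightarrow> real \<times> real \<Rightarrow> real" where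
  "step_sample f x n y m z = (\<Sum>i<n. \<Sum>j<m.
     if z \<in> {x i..<x (Suc i)} \<times> {y j..<y (Suc j)} then f (x i, y j) else 0)"

lemma chain_cell_exists:
  fixes x :: "nat \<Rightarrow> real"
  assumes "s \<in> {x 0..<x n}"
  shows "\<exists>i<n. s \<in> {x i..<x (Suc i)}"
  using assms
proof (induction n)
  case (Suc n)
  then show ?case by (cases "s < x n") (auto simp: less_Suc_eq)
qed simp

lemma chain_cell_unique:
  fixes x :: "nat \<Rightarrow> real"
  assumes "\<forall>i<n. x i < x (Suc i)" "i < n" "i' < n" "s \<in> {x i..<x (Suc i)}" "s \<in> {x i'..<x (Suc i')}"
  shows "i = i'"
  using increasing_chain_mono[OF assms(1), of "Suc i" i'] increasing_chain_mono[OF assms(1), of "Suc i'" i]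
    assms(2-) by (cases i i' rule: linorder_cases) auto

lemma step_sample_eq:
  assumes "\<forall>i<n. x i < x (Suc i)" "\<forall>j<m. y j < y (Suc j)" "i < n" "j < m"
    and "z \<in> {x i..<x (Suc i)} \<times> {y j..<y (Suc j)}"
  shows "step_sample f x n y m z = f (x i, y j)"
proof -
  have z: "fst z \<in> {x i..<x (Suc i)}" "snd z \<in> {y j..<y (Suc j)}"
    using assms(5) by (simp_all add: mem_Times_iff)
  have *: "z \<in> {x i'..<x (Suc i')} \<times> {y j'..<y (Suc j')} \<longleftrightarrow> i' = i \<and> j' = j"
    if "i' < n" "j' < m" for i' j'
    using chain_cell_unique[OF assms(1) that(1) assms(3) _ z(1)]
      chain_cell_unique[OF assms(2) that(2) assms(4) _ z(2)] z mem_Times_iff by metis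
  have "step_sample f x n y m z =
      (\<Sum>i'<n. if i' = i then (\<Sum>j'<m. if j' = j then f (x i, y j) else 0) else 0)"
    unfolding step_sample_def by (intro sum.cong refl) (simp add: * del: mem_Sigma_iff)
  then show ?thesis using assms(3,4) by simp
qed

lemma step_sample_has_integral:
  fixes k l K L :: "real \<Rightarrow> complex"
  assumes kl: "\<And>t. (K has_vector_derivative k t) (at t)" "\<And>t. (L has_vector_derivative l t) (at t)"
    "continuous_on UNIV k" "continuous_on UNIV l"
    and x: "\<forall>i<n. x i < x (Suc i)" and y: "\<forall>j<m. y j < y (Suc j)"
  shows "((\<lambda>z. complex_of_real (step_sample f x n y m z) * (k (fst z) * l (snd z))) has_integral
    (\<Sum>i<n. \<Sum>j<m. complex_of_real (f (x i, y j)) * ((K (x (Suc i)) - K (x i)) * (L (y (Suc j)) - L (y j)))))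
    ({x 0..x n} \<times> {y 0..y m})"
proof -
  let ?R = "{x 0..x n} \<times> {y 0..y m}"
  let ?c = "\<lambda>i j. {x i..<x (Suc i)} \<times> {y j..<y (Suc j)}"
  let ?k = "\<lambda>z. k (fst z) * l (snd z)"
  have cell: "((\<lambda>z. if z \<in> ?c i j then complex_of_real (f (x i, y j)) * ?k z else 0) has_integral
      complex_of_real (f (x i, y j)) * ((K (x (Suc i)) - K (x i)) * (L (y (Suc j)) - L (y j)))) ?R"
    if "i < n" "j < m" for i j
  proof -
    let ?d = "{x i..x (Suc i)} \<times> {y j..y (Suc j)}"
    have "?d - ?c i j \<subseteq> {x (Suc i)} \<times> UNIV \<union> UNIV \<times> {y (Suc j)}" "?c i j - ?d = {}"
      by auto
    moreover have "negligible ({x (Suc i)} \<times> (UNIV :: real set) \<union> UNIV \<times> {y (Suc j)})"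
      by (intro negligible_Un negligible_countable_Times_UNIV) auto
    ultimately have "negligible (?d - ?c i j)" "negligible (?c i j - ?d)"
      using negligible_subset by (blast, metis negligible_empty)
    moreover have "(?k has_integral ((K (x (Suc i)) - K (x i)) * (L (y (Suc j)) - L (y j)))) ?d"
      using x y that by (intro has_integral_product_antiderivatives kl) (auto intro: less_imp_le)
    ultimately have "(?k has_integral ((K (x (Suc i)) - K (x i)) * (L (y (Suc j)) - L (y j)))) (?c i j)"
      by (subst has_integral_spike_set_eq[of _ ?d]) (auto elim: negligible_subset)
    moreover have "?c i j \<subseteq> ?R"
      using increasing_chain_mono[OF x, of 0 i] increasing_chain_mono[OF x, of "Suc i" n]
        increasing_chain_mono[OF y, of 0 j] increasing_chain_mono[OF y, of "Suc j" m] that by auto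
    ultimately show ?thesis
      by (subst has_integral_restrict) (auto intro: has_integral_mult_right)
  qed
  have "((\<lambda>z. \<Sum>i<n. \<Sum>j<m. if z \<in> ?c i j then complex_of_real (f (x i, y j)) * ?k z else 0) has_integral
      (\<Sum>i<n. \<Sum>j<m. complex_of_real (f (x i, y j)) * ((K (x (Suc i)) - K (x i)) * (L (y (Suc j)) - L (y j))))) ?R"
    by (intro has_integral_sum finite_lessThan cell) auto
  moreover have "(\<Sum>i<n. \<Sum>j<m. if z \<in> ?c i j then complex_of_real (f (x i, y j)) * ?k z else 0)
      = complex_of_real (step_sample f x n y m z) * ?k z" for z
    unfolding step_sample_def of_real_sum sum_distrib_right by (intro sum.cong refl) auto
  ultimately show ?thesis by simp
qed

text \<open>There are \<open>Suc N\<close> cells, so that the mesh makes sense for every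
  \<open>N\<close>, including 0.\<close>

definition uniform_grid :: "real \<Rightarrow> real \<Rightarrow> nat \<Rightarrow> nat \<Rightarrow> real" where
  "uniform_grid a b N i = a + real i * ((b - a) / real (Suc N))"

lemma uniform_grid_less: "a < b \<Longrightarrow> uniform_grid a b N i < uniform_grid a b N (Suc i)"
  by (simp add: uniform_grid_def divide_strict_right_mono)

lemma uniform_grid_ends [simp]: "uniform_grid a b N 0 = a" "uniform_grid a b N (Suc N) = b"
  by (simp_all add: uniform_grid_def del: of_nat_Suc)

lemma uniform_grid_mesh: "uniform_grid a b N (Suc i) - uniform_grid a b N i = (b - a) / real (Suc N)"
  unfolding uniform_grid_def of_nat_Suc[of i] by (simp add: distrib_right add_divide_distrib del: of_nat_Suc)

definition uniform_pad_diff :: "(real \<times> real \<Rightarrow> real) \<Rightarrow> real \<Rightarrow> real \<Rightarrow> real \<Rightarrow> real \<Rightarrow> nat \<Rightarrow> nat \<Rightarrow> nat \<Rightarrow> real" where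
  "uniform_pad_diff f a b c d N =
     pad_diff f (uniform_grid a b N) (Suc N) (uniform_grid c d N) (Suc N)"

definition padded_sum ::
    "(real \<times> real \<Rightarrow> real) \<Rightarrow> (real \<Rightarrow> complex) \<Rightarrow> (real \<Rightarrow> complex) \<Rightarrow>
     real \<Rightarrow> real \<Rightarrow> real \<Rightarrow> real \<Rightarrow> nat \<Rightarrow> complex" where
  "padded_sum f K L a b c d N = (\<Sum>i\<le>Suc N. \<Sum>j\<le>Suc N. complex_of_real (uniform_pad_diff f a b c d N i j) *
     (K (uniform_grid a b N i) * L (uniform_grid c d N j)))"

text \<open>The step functions tend to \<open>f\<close> almost everywhere and are dominated, and by
  summation by parts their integrals against the kernel are the padded sums.\<close>

lemma padded_sum_tendsto_integral:
  fixes f :: "real \<times> real \<Rightarrow> real" and k l K L :: "real \<Rightarrow> complex"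
  assumes f: "grid_bounded f B" "(f \<longlongrightarrow> 0) at_infinity"
    and kl: "\<And>t. (K has_vector_derivative k t) (at t)" "\<And>t. (L has_vector_derivative l t) (at t)"
    "continuous_on UNIV k" "continuous_on UNIV l"
    and ab: "a < b" "c < d"
  shows "(\<lambda>z. complex_of_real (f z) * (k (fst z) * l (snd z))) integrable_on ({a..b} \<times> {c..d})"
    and "padded_sum f K L a b c d \<longlonglongrightarrow>
      integral ({a..b} \<times> {c..d}) (\<lambda>z. complex_of_real (f z) * (k (fst z) * l (snd z)))"
proof -
  obtain C D where CD: "countable C" "countable D" "\<And>x y. \<lbrakk>x \<notin> C; y \<notin> D\<rbrakk> \<Longrightarrow> isCont f (x, y)"
    using isCont_off_countable_lines[OF f] by blast
  let ?R = "{a..b} \<times> {c..d}"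
  let ?x = "uniform_grid a b" and ?y = "uniform_grid c d"
  let ?k = "\<lambda>z. k (fst z) * l (snd z)"
  let ?s = "\<lambda>N z. step_sample f (?x N) (Suc N) (?y N) (Suc N) z"
  \<comment> \<open>Besides the lines of possible discontinuity, \<open>S\<close> contains the right
    and upper edges, which no half-open cell covers.\<close>
  define S where "S = insert b C \<times> UNIV \<union> UNIV \<times> insert d D"
  have S: "negligible S"
    unfolding S_def by (intro negligible_Un negligible_countable_Times_UNIV) (use CD in auto)
  have inc: "\<forall>i<Suc N. ?x N i < ?x N (Suc i)" "\<forall>i<Suc N. ?y N i < ?y N (Suc i)" for N
    using ab by (auto simp: uniform_grid_less)
  have sample: "\<exists>x' y'. ?s N (s, t) = f (x', y') \<and> \<bar>x' - s\<bar> \<le> (b - a) / real (Suc N) \<and> \<bar>y' - t\<bar> \<le> (d - c) / real (Suc N)"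
    if "(s, t) \<in> ?R - S" for s t N
  proof -
    have "s \<in> {?x N 0..<?x N (Suc N)}" "t \<in> {?y N 0..<?y N (Suc N)}"
      using that by (auto simp: S_def)
    then obtain i j where ij: "i < Suc N" "j < Suc N" "s \<in> {?x N i..<?x N (Suc i)}" "t \<in> {?y N j..<?y N (Suc j)}"
      using chain_cell_exists by meson
    then have "?s N (s, t) = f (?x N i, ?y N j)"
      by (intro step_sample_eq inc) auto
    moreover have "\<bar>?x N i - s\<bar> \<le> (b - a) / real (Suc N)" "\<bar>?y N j - t\<bar> \<le> (d - c) / real (Suc N)"
      using ij(3,4) uniform_grid_mesh[of a b N i] uniform_grid_mesh[of c d N j] by auto
    ultimately show ?thesis by blast
  qed
  have conv: "(\<lambda>N. ?s N z) \<longlonglongrightarrow> f z" if z: "z \<in> ?R - S" for z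
  proof -
    obtain s t where [simp]: "z = (s, t)" by (cases z)
    have "isCont f (s, t)" using z CD(3) by (auto simp: S_def)
    obtain X Y where XY: "\<And>N. ?s N (s, t) = f (X N, Y N)" "\<And>N. \<bar>X N - s\<bar> \<le> (b - a) / real (Suc N)"
      "\<And>N. \<bar>Y N - t\<bar> \<le> (d - c) / real (Suc N)"
      using sample z by (simp only: \<open>z = (s, t)\<close>) metis
    have "(\<lambda>N. e / real (Suc N)) \<longlonglongrightarrow> 0" for e :: real
      using LIMSEQ_Suc[OF lim_const_over_n[of e]] by simp
    note mesh = this
    have "(\<lambda>N. X N - s) \<longlonglongrightarrow> 0"
      by (rule Lim_null_comparison[OF _ mesh[of "b - a"]]) (use XY(2) in \<open>auto simp del: of_nat_Suc\<close>)
    moreover have "(\<lambda>N. Y N - t) \<longlonglongrightarrow> 0"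
      by (rule Lim_null_comparison[OF _ mesh[of "d - c"]]) (use XY(3) in \<open>auto simp del: of_nat_Suc\<close>)
    ultimately have "X \<longlonglongrightarrow> s" "Y \<longlonglongrightarrow> t"
      using LIM_zero_cancel by blast+
    then have "(\<lambda>N. (X N, Y N)) \<longlonglongrightarrow> (s, t)" by (rule tendsto_Pair)
    then show ?thesis
      using isCont_tendsto_compose[OF \<open>isCont f (s, t)\<close>] XY(1) by simp
  qed
  have "compact (k ` {a..b})" "compact (l ` {c..d})"
    by (intro compact_continuous_image continuous_on_subset[OF kl(3)] continuous_on_subset[OF kl(4)];
        simp)+
  then have "bounded (k ` {a..b})" "bounded (l ` {c..d})"
    using compact_imp_bounded by auto
  then obtain Bk Bl where "\<forall>w\<in>k ` {a..b}. norm w \<le> Bk" "\<forall>w\<in>l ` {c..d}. norm w \<le> Bl"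
    unfolding bounded_iff by blast
  then have Bk: "\<And>t. t \<in> {a..b} \<Longrightarrow> norm (k t) \<le> Bk" and Bl: "\<And>t. t \<in> {c..d} \<Longrightarrow> norm (l t) \<le> Bl"
    by blast+
  have Bk0: "0 \<le> Bk" using Bk[of a] ab by (meson atLeastAtMost_iff less_imp_le norm_ge_zero order_refl order_trans)
  have B0: "0 \<le> B" using abs_le_grid_bound[OF f] by (meson abs_ge_zero order_trans)
  \<comment> \<open>Setting the integrands to 0 on \<open>S\<close> turns almost everywhere
    statements into statements at every point of the rectangle, as dominated convergence
    expects.\<close>
  define g where "g N z = (if z \<in> S then 0 else complex_of_real (?s N z) * ?k z)" for N z
  define h where "h z = (if z \<in> S then 0 else complex_of_real (f z) * ?k z)" for z
  have gi: "(g N has_integral padded_sum f K L a b c d N) ?R" for N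
  proof (rule has_integral_spike[OF S])
    show "((\<lambda>z. complex_of_real (?s N z) * ?k z) has_integral padded_sum f K L a b c d N) ?R"
      using step_sample_has_integral[OF kl inc(1)[of N] inc(2)[of N], of f]
      unfolding padded_sum_def uniform_pad_diff_def summation_by_parts_2d by simp
  qed (auto simp: g_def)
  have dom: "norm (g N z) \<le> B * (Bk * Bl)" if "z \<in> ?R" for N z
  proof (cases "z \<in> S")
    case True
    then show ?thesis
      using B0 Bk0 Bl[of c] ab unfolding g_def
      by (auto intro!: mult_nonneg_nonneg order_trans[OF norm_ge_zero Bl[of c]])
  next
    case False
    then have "\<bar>?s N z\<bar> \<le> B"
      using sample[of "fst z" "snd z" N] that abs_le_grid_bound[OF f] by auto
    moreover have "norm (?k z) \<le> Bk * Bl"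
      unfolding norm_mult using that Bk0 by (intro mult_mono Bk Bl) auto
    ultimately show ?thesis
      using B0 False unfolding g_def by (simp add: norm_mult[of "complex_of_real _"] mult_mono)
  qed
  have lim: "(\<lambda>N. g N z) \<longlonglongrightarrow> h z" if "z \<in> ?R" for z
    using conv[of z] that unfolding g_def h_def
    by (cases "z \<in> S") (auto intro!: tendsto_intros)
  have const: "(\<lambda>z. B * (Bk * Bl)) integrable_on ?R"
    using integrable_const[of "B * (Bk * Bl)" "(a, c)" "(b, d)"] by (simp add: cbox_Pair_eq)
  have gi': "g N integrable_on ?R" for N using gi by blast
  have h: "h integrable_on ?R"
    by (rule dominated_convergence(1)[of g, OF gi' const]) (rule dom lim, assumption)+
  have "(\<lambda>N. integral ?R (g N)) \<longlonglongrightarrow> integral ?R h"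
    by (rule dominated_convergence(2)[of g, OF gi' const]) (rule dom lim, assumption)+
  then have "padded_sum f K L a b c d \<longlonglongrightarrow> integral ?R h"
    using integral_unique[OF gi] by simp
  moreover have "integral ?R (\<lambda>z. complex_of_real (f z) * ?k z) = integral ?R h"
    by (rule integral_spike[OF S]) (auto simp: h_def)
  ultimately show "padded_sum f K L a b c d \<longlonglongrightarrow> integral ?R (\<lambda>z. complex_of_real (f z) * ?k z)"
    by simp
  show "(\<lambda>z. complex_of_real (f z) * ?k z) integrable_on ?R"
    by (rule integrable_spike[OF h S]) (auto simp: h_def)
qed

section \<open>Existence of the transform\<close>

definition osc :: "real \<Rightarrow> real \<Rightarrow> complex" where
  "osc \<xi> t = exp (- (\<i> * complex_of_real (\<xi> * t)))"

text \<open>For nonzero \<xi>, the antiderivative of \<open>osc \<xi>\<close> that has constant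
  modulus.\<close>

definition osc_prim :: "real \<Rightarrow> real \<Rightarrow> complex" where
  "osc_prim \<xi> t = \<i> * osc \<xi> t / complex_of_real \<xi>"

lemma norm_osc [simp]: "cmod (osc \<xi> t) = 1"
  by (simp add: osc_def)

lemma norm_osc_prim: "cmod (osc_prim \<xi> t) = 1 / \<bar>\<xi>\<bar>"
  by (simp add: osc_prim_def norm_mult norm_divide)

lemma continuous_on_osc: "continuous_on S (osc \<xi>)"
  unfolding osc_def by (intro continuous_intros)

lemma osc_prim_has_vector_derivative:
  assumes "\<xi> \<noteq> 0"
  shows "(osc_prim \<xi> has_vector_derivative osc \<xi> t) (at t)"
proof -
  have "((\<lambda>z. \<i> * exp (- (\<i> * (complex_of_real \<xi> * z))) / complex_of_real \<xi>) has_field_derivative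
      exp (- (\<i> * (complex_of_real \<xi> * complex_of_real t)))) (at (complex_of_real t))"
    using assms by (auto intro!: derivative_eq_intros simp: field_simps)
  then have "((\<lambda>t. \<i> * exp (- (\<i> * (complex_of_real \<xi> * complex_of_real t))) / complex_of_real \<xi>) has_vector_derivative
      exp (- (\<i> * (complex_of_real \<xi> * complex_of_real t)))) (at t)"
    by (rule has_vector_derivative_real_field)
  then show ?thesis
    by (simp add: osc_prim_def[abs_def] osc_def)
qed

lemma KP_integrand_osc:
  "KP_integrand f \<xi> \<eta> = (\<lambda>z. complex_of_real (f z) * (osc \<xi> (fst z) * osc \<eta> (snd z)))"
  unfolding KP_integrand_def osc_def exp_add[symmetric]
  by (auto simp: fun_eq_iff distrib_left)

lemma norm_padded_sum_le:
  assumes "\<And>t. cmod (K t) \<le> BK" "\<And>t. cmod (L t) \<le> BL"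
    and "(\<Sum>i\<le>Suc N. \<Sum>j\<le>Suc N. \<bar>uniform_pad_diff f a b c d N i j\<bar>) \<le> W"
  shows "cmod (padded_sum f K L a b c d N) \<le> W * (BK * BL)"
proof -
  have BK: "0 \<le> BK" using assms(1) norm_ge_zero order_trans by blast
  have BL: "0 \<le> BL" using assms(2) norm_ge_zero order_trans by blast
  have "cmod (padded_sum f K L a b c d N) \<le>
      (\<Sum>i\<le>Suc N. \<Sum>j\<le>Suc N. \<bar>uniform_pad_diff f a b c d N i j\<bar> * (BK * BL))"
    unfolding padded_sum_def
    by (intro sum_norm_le) (auto simp: norm_mult intro!: mult_left_mono mult_mono assms(1,2) BK BL)
  also have "\<dots> = (\<Sum>i\<le>Suc N. \<Sum>j\<le>Suc N. \<bar>uniform_pad_diff f a b c d N i j\<bar>) * (BK * BL)"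
    by (simp only: sum_distrib_right)
  also have "\<dots> \<le> W * (BK * BL)"
    using BK BL by (intro mult_right_mono assms(3)) auto
  finally show ?thesis .
qed

lemma uniform_pad_diff_sum_le:
  assumes "grid_bounded f B" "(f \<longlongrightarrow> 0) at_infinity" "a < b" "c < d"
  shows "(\<Sum>i\<le>Suc N. \<Sum>j\<le>Suc N. \<bar>uniform_pad_diff f a b c d N i j\<bar>) \<le> B"
  unfolding uniform_pad_diff_def
  by (rule pad_diff_sum_le[OF assms(1,2)]) (use assms(3,4) uniform_grid_less in auto)

context
  fixes f :: "real \<times> real \<Rightarrow> real" and B :: real
  assumes grid_bounded: "grid_bounded f B" and vanishing: "(f \<longlongrightarrow> 0) at_infinity"
begin

lemma grid_bound_nonneg: "0 \<le> B"
  using abs_le_grid_bound[OF grid_bounded vanishing, of 0 0] by linarith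

lemma padded_osc_sum_tendsto:
  assumes "\<xi> \<noteq> 0" "\<eta> \<noteq> 0" "a < b" "c < d"
  shows "KP_integrand f \<xi> \<eta> integrable_on ({a..b} \<times> {c..d})"
    and "padded_sum f (osc_prim \<xi>) (osc_prim \<eta>) a b c d \<longlonglongrightarrow> KP_truncated f \<xi> \<eta> (a, b, c, d)"
  unfolding KP_truncated_def KP_integrand_osc case_prod_conv
  by (rule padded_sum_tendsto_integral[OF grid_bounded vanishing osc_prim_has_vector_derivative
        osc_prim_has_vector_derivative continuous_on_osc continuous_on_osc assms(3,4)]; fact assms)+

text \<open>Such a box is empty or lies in a line. \<open>KP_Fourier_exists\<close> ranges over all
  bounds, and the subdivisions below may also produce such boxes.\<close>

lemma has_integral_degenerate_box:
  fixes g :: "real \<times> real \<Rightarrow> complex"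
  assumes "\<not> (a < b \<and> c < d)"
  shows "(g has_integral 0) ({a..b} \<times> {c..d})"
proof (rule has_integral_negligible)
  have "{a..b} \<times> {c..d} \<subseteq> {a} \<times> UNIV \<union> UNIV \<times> {c}"
    using assms by auto
  moreover have "negligible ({a} \<times> (UNIV :: real set) \<union> (UNIV :: real set) \<times> {c})"
    by (intro negligible_Un negligible_countable_Times_UNIV) auto
  ultimately show "negligible ({a..b} \<times> {c..d})" by (rule negligible_subset[rotated])
qed simp

lemma KP_integrand_integrable:
  assumes "\<xi> \<noteq> 0" "\<eta> \<noteq> 0"
  shows "KP_integrand f \<xi> \<eta> integrable_on ({a..b} \<times> {c..d})"
proof (cases "a < b \<and> c < d")
  case True
  then show ?thesis using padded_osc_sum_tendsto assms by blast
next
  case False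
  then show ?thesis
    using has_integral_degenerate_box by blast
qed

lemma norm_KP_truncated_le:
  assumes "\<xi> \<noteq> 0" "\<eta> \<noteq> 0"
    and "\<And>N. \<lbrakk>a < b; c < d\<rbrakk> \<Longrightarrow> (\<Sum>i\<le>Suc N. \<Sum>j\<le>Suc N. \<bar>uniform_pad_diff f a b c d N i j\<bar>) \<le> W"
    and "0 \<le> W"
  shows "cmod (KP_truncated f \<xi> \<eta> (a, b, c, d)) \<le> W * (1 / \<bar>\<xi>\<bar> * (1 / \<bar>\<eta>\<bar>))"
proof (cases "a < b \<and> c < d")
  case True
  show ?thesis
  proof (rule Lim_norm_ubound)
    show "padded_sum f (osc_prim \<xi>) (osc_prim \<eta>) a b c d \<longlonglongrightarrow> KP_truncated f \<xi> \<eta> (a, b, c, d)"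
      using padded_osc_sum_tendsto assms True by blast
    show "\<forall>\<^sub>F N in sequentially. cmod (padded_sum f (osc_prim \<xi>) (osc_prim \<eta>) a b c d N) \<le> W * (1 / \<bar>\<xi>\<bar> * (1 / \<bar>\<eta>\<bar>))"
      by (intro always_eventually allI norm_padded_sum_le assms(3)) (use True norm_osc_prim in auto)
  qed simp
next
  case False
  then have "KP_truncated f \<xi> \<eta> (a, b, c, d) = 0"
    using has_integral_degenerate_box by (auto simp: KP_truncated_def integral_unique)
  then show ?thesis using assms(4) by simp
qed

text \<open>On a box in a tail the padded weights total at most \<open>3 * e\<close>, however long
  its other side is. Tails in y are tails in x of the swapped function.\<close>

lemma KP_truncated_tail:
  assumes "\<xi> \<noteq> 0" "\<eta> \<noteq> 0" "\<epsilon> > 0"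
  obtains M where "M > 0"
    "\<And>a b c d. (b \<le> - M \<or> M \<le> a) \<or> (d \<le> - M \<or> M \<le> c) \<Longrightarrow> cmod (KP_truncated f \<xi> \<eta> (a, b, c, d)) \<le> \<epsilon>"
proof -
  \<comment> \<open>Chosen so that
    \<open>3 * e * (1 / \<bar>\<xi>\<bar> * (1 / \<bar>\<eta>\<bar>))\<close> is \<epsilon>; the 3
    is that of the tail estimate.\<close>
  define e where "e = \<epsilon> * \<bar>\<xi>\<bar> * \<bar>\<eta>\<bar> / 3"
  have e: "e > 0" using assms by (simp add: e_def)
  note swap = grid_bounded_swap[OF grid_bounded] tendsto_swap_at_infinity[OF vanishing]
  obtain M1 where M1: "M1 > 0"
    "\<And>xs ys. \<lbrakk>sorted xs; sorted ys; set xs \<subseteq> {..-M1} \<or> set xs \<subseteq> {M1..}\<rbrakk> \<Longrightarrow> tv2 f xs ys \<le> e"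
    using tv2_tail_small[OF grid_bounded e] by blast
  obtain M2 where M2: "M2 > 0"
    "\<And>xs ys. \<lbrakk>sorted xs; sorted ys; set xs \<subseteq> {..-M2} \<or> set xs \<subseteq> {M2..}\<rbrakk> \<Longrightarrow> tv2 (f \<circ> prod.swap) xs ys \<le> e"
    using tv2_tail_small[OF swap(1) e] by blast
  show ?thesis
  proof (rule that[of "max M1 M2"])
    fix a b c d assume tail: "(b \<le> - max M1 M2 \<or> max M1 M2 \<le> a) \<or> (d \<le> - max M1 M2 \<or> max M1 M2 \<le> c)"
    have "cmod (KP_truncated f \<xi> \<eta> (a, b, c, d)) \<le> (3 * e) * (1 / \<bar>\<xi>\<bar> * (1 / \<bar>\<eta>\<bar>))"
    proof (rule norm_KP_truncated_le[OF assms(1,2)])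
      fix N assume "a < b" "c < d"
      then have inc: "\<forall>i<Suc N. uniform_grid a b N i < uniform_grid a b N (Suc i)"
        "\<forall>i<Suc N. uniform_grid c d N i < uniform_grid c d N (Suc i)"
        using uniform_grid_less by auto
      from tail show "(\<Sum>i\<le>Suc N. \<Sum>j\<le>Suc N. \<bar>uniform_pad_diff f a b c d N i j\<bar>) \<le> 3 * e"
      proof
        assume "b \<le> - max M1 M2 \<or> max M1 M2 \<le> a"
        then have d: "uniform_grid a b N (Suc N) \<le> - M1 \<or> M1 \<le> uniform_grid a b N 0" by auto
        show ?thesis
          unfolding uniform_pad_diff_def by (rule pad_diff_sum_tail_le[OF vanishing M1(1) _ inc d]) (rule M1(2))
      next
        assume "d \<le> - max M1 M2 \<or> max M1 M2 \<le> c"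
        then have d: "uniform_grid c d N (Suc N) \<le> - M2 \<or> M2 \<le> uniform_grid c d N 0" by auto
        have "(\<Sum>j\<le>Suc N. \<Sum>i\<le>Suc N. \<bar>pad_diff (f \<circ> prod.swap) (uniform_grid c d N) (Suc N) (uniform_grid a b N) (Suc N) j i\<bar>) \<le> 3 * e"
          by (rule pad_diff_sum_tail_le[OF swap(2) M2(1) _ inc(2,1) d]) (rule M2(2))
        then show ?thesis
          unfolding uniform_pad_diff_def pad_diff_swap by (subst sum.swap)
      qed
    qed (use e in simp)
    also have "\<dots> = \<epsilon>" using assms by (simp add: e_def)
    finally show "cmod (KP_truncated f \<xi> \<eta> (a, b, c, d)) \<le> \<epsilon>" .
  qed (use M1 in simp)
qed

lemma KP_truncated_split:
  assumes "\<xi> \<noteq> 0" "\<eta> \<noteq> 0" "a \<le> m" "m \<le> b"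
  shows "KP_truncated f \<xi> \<eta> (a, b, c, d) = KP_truncated f \<xi> \<eta> (a, m, c, d) + KP_truncated f \<xi> \<eta> (m, b, c, d)"
    and "KP_truncated f \<xi> \<eta> (c, d, a, b) = KP_truncated f \<xi> \<eta> (c, d, a, m) + KP_truncated f \<xi> \<eta> (c, d, m, b)"
proof -
  have n: "negligible ({m} \<times> (UNIV :: real set))" "negligible ((UNIV :: real set) \<times> {m})"
    by (rule negligible_countable_Times_UNIV; simp)+
  have 1: "{a..b} \<times> {c..d} = {a..m} \<times> {c..d} \<union> {m..b} \<times> {c..d}"
    and 2: "{c..d} \<times> {a..b} = {c..d} \<times> {a..m} \<union> {c..d} \<times> {m..b}"
    using assms by auto
  show "KP_truncated f \<xi> \<eta> (a, b, c, d) = KP_truncated f \<xi> \<eta> (a, m, c, d) + KP_truncated f \<xi> \<eta> (m, b, c, d)"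
    unfolding KP_truncated_def case_prod_conv 1
    by (intro integral_Un KP_integrand_integrable assms(1,2) negligible_subset[OF n(1)]) auto
  show "KP_truncated f \<xi> \<eta> (c, d, a, b) = KP_truncated f \<xi> \<eta> (c, d, a, m) + KP_truncated f \<xi> \<eta> (c, d, m, b)"
    unfolding KP_truncated_def case_prod_conv 2
    by (intro integral_Un KP_integrand_integrable assms(1,2) negligible_subset[OF n(2)]) auto
qed

text \<open>The larger box exceeds the smaller by a left and a right slab of full height and a lower
  and an upper piece over the middle: four tail boxes, with \<open>\<epsilon> / 4\<close> for
  each.\<close>

lemma KP_truncated_nested:
  assumes "\<xi> \<noteq> 0" "\<eta> \<noteq> 0" "\<epsilon> > 0"
  obtains M where "M > 0"
    "\<And>a b c d a' b' c' d'. \<lbrakk>a' \<le> a; a \<le> - M; M \<le> b; b \<le> b'; c' \<le> c; c \<le> - M; M \<le> d; d \<le> d'\<rbrakk>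
      \<Longrightarrow> cmod (KP_truncated f \<xi> \<eta> (a', b', c', d') - KP_truncated f \<xi> \<eta> (a, b, c, d)) \<le> \<epsilon>"
proof -
  let ?T = "\<lambda>a b c d. KP_truncated f \<xi> \<eta> (a, b, c, d)"
  have "\<epsilon> / 4 > 0" using assms by simp
  then obtain M where M: "M > 0"
    "\<And>a b c d. (b \<le> - M \<or> M \<le> a) \<or> (d \<le> - M \<or> M \<le> c) \<Longrightarrow> cmod (?T a b c d) \<le> \<epsilon> / 4"
    using KP_truncated_tail[OF assms(1,2)] by blast
  show ?thesis
  proof (rule that[OF M(1)])
    fix a b c d a' b' c' d'
    assume h: "a' \<le> a" "a \<le> - M" "M \<le> b" "b \<le> b'" "c' \<le> c" "c \<le> - M" "M \<le> d" "d \<le> d'"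
    have "?T a' b' c' d' = ?T a' a c' d' + (?T a b c' d' + ?T b b' c' d')"
      using h M(1) KP_truncated_split(1)[OF assms(1,2), of a' a b' c' d'] KP_truncated_split(1)[OF assms(1,2), of a b b' c' d'] by simp
    moreover have "?T a b c' d' = ?T a b c' c + (?T a b c d + ?T a b d d')"
      using h M(1) KP_truncated_split(2)[OF assms(1,2), of c' c d' a b] KP_truncated_split(2)[OF assms(1,2), of c d d' a b] by simp
    ultimately have eq: "?T a' b' c' d' - ?T a b c d = (?T a' a c' d' + ?T b b' c' d') + (?T a b c' c + ?T a b d d')"
      by simp
    have "cmod (?T a' a c' d') \<le> \<epsilon> / 4" "cmod (?T b b' c' d') \<le> \<epsilon> / 4" "cmod (?T a b c' c) \<le> \<epsilon> / 4" "cmod (?T a b d d') \<le> \<epsilon> / 4"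
      by (rule M(2), use h in simp)+
    then show "cmod (?T a' b' c' d' - ?T a b c d) \<le> \<epsilon>"
      unfolding eq by (intro order_trans[OF norm_triangle_mono[OF norm_triangle_mono norm_triangle_mono]]) auto
  qed
qed

text \<open>A Cauchy argument on growing squares produces the limit, and nestedness carries it over
  to boxes with independent sides. The sequential form is kept because dominated convergence works
  along sequences.\<close>

lemma KP_truncated_tendsto:
  assumes "\<xi> \<noteq> 0" "\<eta> \<noteq> 0"
  obtains L where "(KP_truncated f \<xi> \<eta> \<longlongrightarrow> L) pringsheim"
    "(\<lambda>N. KP_truncated f \<xi> \<eta> (- real (Suc N), real (Suc N), - real (Suc N), real (Suc N))) \<longlonglongrightarrow> L"
proof -
  let ?T = "\<lambda>a b c d. KP_truncated f \<xi> \<eta> (a, b, c, d)"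
  define s where "s N = ?T (- real (Suc N)) (real (Suc N)) (- real (Suc N)) (real (Suc N))" for N
  have "Cauchy s"
    unfolding Cauchy_def
  proof (intro allI impI)
    fix e :: real assume "e > 0"
    then have "e / 2 > 0" by simp
    then obtain M where M: "M > 0"
      "\<And>a b c d a' b' c' d'. \<lbrakk>a' \<le> a; a \<le> - M; M \<le> b; b \<le> b'; c' \<le> c; c \<le> - M; M \<le> d; d \<le> d'\<rbrakk>
        \<Longrightarrow> cmod (?T a' b' c' d' - ?T a b c d) \<le> e / 2"
      using KP_truncated_nested[OF assms] by metis
    obtain N0 where N0: "M \<le> real N0" using real_arch_simple by blast
    have *: "dist (s n) (s m) < e" if "N0 \<le> m" "m \<le> n" for m n
    proof -
      have "cmod (s n - s m) \<le> e / 2"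
        unfolding s_def by (rule M(2)) (use that N0 in auto)
      then show ?thesis using \<open>e > 0\<close> by (simp add: dist_norm)
    qed
    show "\<exists>N0. \<forall>m\<ge>N0. \<forall>n\<ge>N0. dist (s m) (s n) < e"
    proof (intro exI[of _ N0] allI impI)
      fix m n assume "m \<ge> N0" "n \<ge> N0"
      then show "dist (s m) (s n) < e"
        using *[of m n] *[of n m] by (cases "m \<le> n") (auto simp: dist_commute)
    qed
  qed
  then obtain L where L: "s \<longlonglongrightarrow> L"
    using Cauchy_convergent_iff convergent_def by blast
  have "(KP_truncated f \<xi> \<eta> \<longlongrightarrow> L) pringsheim"
    unfolding tendsto_iff
  proof (intro allI impI)
    fix e :: real assume "e > 0"
    then have "e / 2 > 0" by simp
    then obtain M where M: "M > 0"
      "\<And>a b c d a' b' c' d'. \<lbrakk>a' \<le> a; a \<le> - M; M \<le> b; b \<le> b'; c' \<le> c; c \<le> - M; M \<le> d; d \<le> d'\<rbrakk>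
        \<Longrightarrow> cmod (?T a' b' c' d' - ?T a b c d) \<le> e / 2"
      using KP_truncated_nested[OF assms] by metis
    have "\<forall>\<^sub>F r in pringsheim. fst r \<le> - M \<and> fst (snd r) \<ge> M \<and> fst (snd (snd r)) \<le> - M \<and> snd (snd (snd r)) \<ge> M"
      unfolding pringsheim_def
      by (intro eventually_prodI eventually_le_at_bot eventually_ge_at_top)
    then show "\<forall>\<^sub>F r in pringsheim. dist (KP_truncated f \<xi> \<eta> r) L < e"
    proof eventually_elim
      case (elim r)
      obtain a b c d where [simp]: "r = (a, b, c, d)" by (cases r)
      have "\<forall>\<^sub>F N in sequentially. dist (s N) L < e / 2"
        using L \<open>e / 2 > 0\<close> tendstoD by blast
      moreover have "\<forall>\<^sub>F N in sequentially. real N \<ge> max (max (- a) b) (max (- c) d)"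
        using filterlim_real_sequentially filterlim_at_top by blast
      \<comment> \<open>The square must be large enough both to be near \<open>L\<close> in value
        and to contain the box \<open>r\<close>, so that nestedness compares the two.\<close>
      ultimately obtain N where N: "dist (s N) L < e / 2" "real N \<ge> max (max (- a) b) (max (- c) d)"
        using eventually_happens'[OF sequentially_bot eventually_conj] by blast
      have "cmod (s N - ?T a b c d) \<le> e / 2"
        unfolding s_def by (rule M(2)) (use N(2) elim in auto)
      then have "dist (?T a b c d) (s N) \<le> e / 2" by (simp add: dist_norm norm_minus_commute)
      then show ?case using N(1) dist_triangle[of "?T a b c d" L "s N"] by simp
    qed
  qed
  then show ?thesis using L that unfolding s_def by blast
qed

lemma KP_Fourier_exists_nonzero:
  assumes "\<xi> \<noteq> 0" "\<eta> \<noteq> 0"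
  shows "KP_Fourier_exists f \<xi> \<eta>"
  using KP_integrand_integrable[OF assms] KP_truncated_tendsto[OF assms]
  unfolding KP_Fourier_exists_def by metis

lemma KP_truncated_tendsto_KP_Fourier:
  assumes "\<xi> \<noteq> 0" "\<eta> \<noteq> 0"
  shows "(\<lambda>N. KP_truncated f \<xi> \<eta> (- real (Suc N), real (Suc N), - real (Suc N), real (Suc N))) \<longlonglongrightarrow> KP_Fourier f \<xi> \<eta>"
proof -
  obtain L where L: "(KP_truncated f \<xi> \<eta> \<longlongrightarrow> L) pringsheim"
    "(\<lambda>N. KP_truncated f \<xi> \<eta> (- real (Suc N), real (Suc N), - real (Suc N), real (Suc N))) \<longlonglongrightarrow> L"
    using KP_truncated_tendsto[OF assms] by blast
  have "pringsheim \<noteq> bot"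
    by (simp add: pringsheim_def prod_filter_eq_bot)
  then have "KP_Fourier f \<xi> \<eta> = L"
    unfolding KP_Fourier_def using L(1) by (rule tendsto_Lim)
  then show ?thesis using L(2) by simp
qed

lemma norm_KP_truncated_le_bound:
  assumes "\<xi> \<noteq> 0" "\<eta> \<noteq> 0"
  shows "cmod (KP_truncated f \<xi> \<eta> (a, b, c, d)) \<le> B * (1 / \<bar>\<xi>\<bar> * (1 / \<bar>\<eta>\<bar>))"
  by (rule norm_KP_truncated_le[OF assms uniform_pad_diff_sum_le[OF grid_bounded vanishing] grid_bound_nonneg])

end

section \<open>Sine integrals over frequency bands\<close>

definition freq_sine :: "real \<Rightarrow> real \<Rightarrow> real \<Rightarrow> real" where
  "freq_sine \<alpha> s t = integral {\<alpha>..s} (\<lambda>\<xi>. sin (\<xi> * t) / \<xi>)"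

lemma freq_sine_integrable:
  fixes \<alpha> s t :: real
  assumes "0 < \<alpha>"
  shows "(\<lambda>\<xi>. sin (\<xi> * t) / \<xi>) integrable_on {\<alpha>..s}"
  by (rule integrable_continuous_interval, intro continuous_intros) (use assms in auto)

lemma freq_sine_combine:
  assumes "0 < \<alpha>" "\<alpha> \<le> m" "m \<le> s"
  shows "freq_sine \<alpha> s t = freq_sine \<alpha> m t + freq_sine m s t"
  unfolding freq_sine_def
  by (rule Henstock_Kurzweil_Integration.integral_combine[OF assms(2,3) freq_sine_integrable[OF assms(1)], symmetric])

text \<open>The integrand is at most \<open>\<bar>t\<bar>\<close> because
  \<open>\<bar>sin z\<bar> \<le> \<bar>z\<bar>\<close>; this is effective at low
  frequencies.\<close>

lemma abs_freq_sine_le_width: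
  assumes "0 < \<alpha>" "\<alpha> \<le> s"
  shows "\<bar>freq_sine \<alpha> s t\<bar> \<le> (s - \<alpha>) * \<bar>t\<bar>"
proof -
  have "norm (freq_sine \<alpha> s t) \<le> integral {\<alpha>..s} (\<lambda>_. \<bar>t\<bar>)"
    unfolding freq_sine_def
  proof (rule integral_norm_bound_integral[OF freq_sine_integrable[OF assms(1)]])
    fix \<xi> assume "\<xi> \<in> {\<alpha>..s}"
    then have "0 < \<xi>" using assms by auto
    then show "norm (sin (\<xi> * t) / \<xi>) \<le> \<bar>t\<bar>"
      using abs_sin_x_le_abs_x[of "\<xi> * t"] by (simp add: abs_mult divide_le_eq mult.commute)
  qed auto
  then show ?thesis using assms(2) by simp
qed

text \<open>Integration by parts: the boundary terms are at most
  \<open>1 / (s * \<bar>t\<bar>) + 1 / (\<alpha> * \<bar>t\<bar>)\<close>, the remaining integral at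
  most \<open>1 / (\<alpha> * \<bar>t\<bar>) - 1 / (s * \<bar>t\<bar>)\<close>, and the dependence
  on \<open>s\<close> cancels.\<close>

lemma abs_freq_sine_le_decay:
  assumes "0 < \<alpha>" "\<alpha> \<le> s" "t \<noteq> 0"
  shows "\<bar>freq_sine \<alpha> s t\<bar> \<le> 2 / (\<alpha> * \<bar>t\<bar>)"
proof -
  have pos: "0 < \<xi>" if "\<xi> \<in> {\<alpha>..s}" for \<xi> using that assms by auto
  define F where "F \<xi> = - cos (\<xi> * t) / (t * \<xi>)" for \<xi>
  define G where "G \<xi> = cos (\<xi> * t) / (t * \<xi>\<^sup>2)" for \<xi>
  have Gi: "G integrable_on {\<alpha>..s}"
    unfolding G_def by (rule integrable_continuous_interval, intro continuous_intros) (use assms in auto)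
  have "((\<lambda>\<xi>. sin (\<xi> * t) / \<xi> + G \<xi>) has_integral (F s - F \<alpha>)) {\<alpha>..s}"
  proof (rule fundamental_theorem_of_calculus[OF assms(2)])
    fix \<xi> assume "\<xi> \<in> {\<alpha>..s}"
    then have "\<xi> \<noteq> 0" using pos by force
    have num: "((\<lambda>\<xi>. - cos (\<xi> * t)) has_real_derivative sin (\<xi> * t) * t) (at \<xi>)"
      and den: "((\<lambda>\<xi>. t * \<xi>) has_real_derivative t) (at \<xi>)"
      by (auto intro!: derivative_eq_intros)
    have "(S * t * (t * \<xi>) - (- C) * t) / (t * \<xi> * (t * \<xi>)) = S / \<xi> + C / (t * \<xi>\<^sup>2)" for S C
      using \<open>\<xi> \<noteq> 0\<close> assms(3) by (simp add: field_simps power2_eq_square)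
    then have "(F has_real_derivative (sin (\<xi> * t) / \<xi> + G \<xi>)) (at \<xi>)"
      using DERIV_divide[OF num den] \<open>\<xi> \<noteq> 0\<close> assms(3) unfolding F_def G_def by simp
    then show "(F has_vector_derivative (sin (\<xi> * t) / \<xi> + G \<xi>)) (at \<xi> within {\<alpha>..s})"
      by (rule has_vector_derivative_at_within[OF has_real_derivative_iff_has_vector_derivative[THEN iffD1]])
  qed
  then have eq: "freq_sine \<alpha> s t = F s - F \<alpha> - integral {\<alpha>..s} G"
    unfolding freq_sine_def
    using integral_add[OF freq_sine_integrable[OF assms(1)] Gi, of t] by (simp add: integral_unique)
  have "((\<lambda>\<xi>. 1 / (\<bar>t\<bar> * \<xi>\<^sup>2)) has_integral (- 1 / (\<bar>t\<bar> * s) - (- 1 / (\<bar>t\<bar> * \<alpha>)))) {\<alpha>..s}"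
  proof (rule fundamental_theorem_of_calculus[OF assms(2)])
    fix \<xi> assume "\<xi> \<in> {\<alpha>..s}"
    then have "\<xi> \<noteq> 0" using pos by force
    then have "((\<lambda>\<xi>. - 1 / (\<bar>t\<bar> * \<xi>)) has_real_derivative (1 / (\<bar>t\<bar> * \<xi>\<^sup>2))) (at \<xi>)"
      using assms(3) by (auto intro!: derivative_eq_intros simp: field_simps power2_eq_square)
    then show "((\<lambda>\<xi>. - 1 / (\<bar>t\<bar> * \<xi>)) has_vector_derivative (1 / (\<bar>t\<bar> * \<xi>\<^sup>2))) (at \<xi> within {\<alpha>..s})"
      by (rule has_vector_derivative_at_within[OF has_real_derivative_iff_has_vector_derivative[THEN iffD1]])
  qed
  note H = this
  have "norm (integral {\<alpha>..s} G) \<le> integral {\<alpha>..s} (\<lambda>\<xi>. 1 / (\<bar>t\<bar> * \<xi>\<^sup>2))"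
  proof (rule integral_norm_bound_integral[OF Gi])
    show "norm (G \<xi>) \<le> 1 / (\<bar>t\<bar> * \<xi>\<^sup>2)" for \<xi>
      by (auto simp: G_def abs_mult intro!: divide_right_mono)
  qed (use H in blast)
  then have "\<bar>integral {\<alpha>..s} G\<bar> \<le> 1 / (\<alpha> * \<bar>t\<bar>) - 1 / (s * \<bar>t\<bar>)"
    using integral_unique[OF H] by (simp add: mult.commute)
  moreover have "\<bar>F \<xi>\<bar> \<le> 1 / (\<xi> * \<bar>t\<bar>)" if "0 < \<xi>" for \<xi>
    using that by (auto simp: F_def abs_mult mult.commute intro!: divide_right_mono)
  then have "\<bar>F s\<bar> \<le> 1 / (s * \<bar>t\<bar>)" "\<bar>F \<alpha>\<bar> \<le> 1 / (\<alpha> * \<bar>t\<bar>)"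
    using assms by auto
  moreover have "2 / (\<alpha> * \<bar>t\<bar>) = 1 / (\<alpha> * \<bar>t\<bar>) + 1 / (\<alpha> * \<bar>t\<bar>)"
    by (simp add: add_divide_distrib[symmetric])
  ultimately show ?thesis unfolding eq by linarith
qed

text \<open>The cases are those of a band below, above, or around the frequency \<open>1 / \<bar>t\<bar>\<close>.\<close>

definition band_bound :: "(nat \<Rightarrow> real) \<Rightarrow> real \<Rightarrow> nat \<Rightarrow> real" where
  "band_bound u t p =
     (if u (Suc p) * \<bar>t\<bar> \<le> 1 then (u (Suc p) - u p) * \<bar>t\<bar>
      else if 1 \<le> u p * \<bar>t\<bar> then 2 / (u p * \<bar>t\<bar>) else 3)"

lemma abs_freq_sine_le_band_bound:
  assumes "0 < u p" "s \<in> {u p..u (Suc p)}"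
  shows "\<bar>freq_sine (u p) s t\<bar> \<le> band_bound u t p"
proof -
  have s: "u p \<le> s" "s \<le> u (Suc p)" "0 < s" using assms by auto
  consider (low) "u (Suc p) * \<bar>t\<bar> \<le> 1" | (high) "\<not> u (Suc p) * \<bar>t\<bar> \<le> 1" "1 \<le> u p * \<bar>t\<bar>"
    | (mid) "\<not> u (Suc p) * \<bar>t\<bar> \<le> 1" "u p * \<bar>t\<bar> < 1" by linarith
  then show ?thesis
  proof cases
    case low
    have "(s - u p) * \<bar>t\<bar> \<le> (u (Suc p) - u p) * \<bar>t\<bar>"
      using s by (intro mult_right_mono) auto
    then show ?thesis
      using low abs_freq_sine_le_width[OF assms(1) s(1), of t] by (simp add: band_bound_def)
  next
    case high
    then have "t \<noteq> 0" by auto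
    then show ?thesis
      using high abs_freq_sine_le_decay[OF assms(1) s(1), of t] by (simp add: band_bound_def)
  next
    case mid
    then have t: "t \<noteq> 0" by auto
    \<comment> \<open>The band is cut at \<open>m\<close>: the width estimate gives 1 below it, the
      decay estimate \<open>2 / (m * \<bar>t\<bar>) = 2\<close> above.\<close>
    define m where "m = 1 / \<bar>t\<bar>"
    have m: "u p \<le> m" "m * \<bar>t\<bar> = 1" "0 < m" using mid t by (auto simp: m_def field_simps)
    have width: "\<bar>freq_sine (u p) r t\<bar> \<le> 1" if "u p \<le> r" "r \<le> m" for r
    proof -
      have "(r - u p) * \<bar>t\<bar> \<le> m * \<bar>t\<bar>" using that assms by (intro mult_right_mono) auto
      then show ?thesis using abs_freq_sine_le_width[OF assms(1) that(1), of t] m by linarith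
    qed
    have "\<bar>freq_sine (u p) s t\<bar> \<le> 3"
    proof (cases "s \<le> m")
      case True
      then show ?thesis using width[OF s(1)] by simp
    next
      case False
      then have "\<bar>freq_sine m s t\<bar> \<le> 2"
        using abs_freq_sine_le_decay[OF m(3) _ t, of s] m(2) by simp
      then show ?thesis
        using width[OF m(1)] freq_sine_combine[OF assms(1) m(1), of s t] False by simp
    qed
    then show ?thesis using mid by (simp add: band_bound_def)
  qed
qed

lemma sum_band_bound_le:
  assumes "cond_L A u"
  shows "(\<Sum>p=1..N. band_bound u t p) \<le> 3 * A + 4"
proof -
  define \<tau> where "\<tau> = \<bar>t\<bar>"
  have \<tau>: "0 \<le> \<tau>" by (simp add: \<tau>_def)
  have A: "A > 1" and pos: "\<And>j. 1 \<le> j \<Longrightarrow> 0 < u j" and mono: "mono_on {1..} u"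
    and L: "\<And>m. 1 \<le> m \<Longrightarrow> summable (\<lambda>j. 1 / u (m + j))" "\<And>m. 1 \<le> m \<Longrightarrow> u m * (\<Sum>j. 1 / u (m + j)) \<le> A"
    using assms by (auto simp: cond_L_def)
  have le: "u p \<le> u q" if "1 \<le> p" "p \<le> q" for p q
    using mono_onD[OF mono, of p q] that by auto
  define lo where "lo p = (if u (Suc p) * \<tau> \<le> 1 then (u (Suc p) - u p) * \<tau> else 0)" for p
  define mi where "mi p = (if \<not> u (Suc p) * \<tau> \<le> 1 \<and> \<not> 1 \<le> u p * \<tau> then 3 else 0 :: real)" for p
  define hi where "hi p = (if 1 \<le> u p * \<tau> then 2 / (u p * \<tau>) else 0)" for p
  \<comment> \<open>An inequality only: if \<open>u p * \<tau>\<close> and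
    \<open>u (Suc p) * \<tau>\<close> both equal 1, the band enters both \<open>lo\<close> and
    \<open>hi\<close>.\<close>
  have split: "band_bound u t p \<le> lo p + mi p + hi p" if "1 \<le> p" for p
    using pos[OF that] \<tau> by (auto simp: band_bound_def lo_def mi_def hi_def \<tau>_def)
  \<comment> \<open>Telescoping as an invariant: the partial sum never exceeds the last scaled
    frequency, and nothing is added once that frequency passes 1.\<close>
  have lo: "(\<Sum>p=1..n. lo p) \<le> min 1 (u (Suc n) * \<tau>)" for n
  proof (induction n)
    case 0
    then show ?case using pos[of 1] \<tau> by simp
  next
    case (Suc n)
    have "u (Suc n) * \<tau> \<le> u (Suc (Suc n)) * \<tau>" by (intro mult_right_mono le \<tau>) auto
    then show ?case using Suc by (auto simp: lo_def left_diff_distrib)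
  qed
  \<comment> \<open>By monotonicity at most one band straddles 1; before it the partial sum is still
    0.\<close>
  have mi: "(\<Sum>p=1..n. mi p) \<le> (if u (Suc n) * \<tau> \<le> 1 then 0 else 3)" for n
  proof (induction n)
    case (Suc n)
    have "u (Suc n) * \<tau> \<le> u (Suc (Suc n)) * \<tau>" by (intro mult_right_mono le \<tau>) auto
    then show ?case using Suc by (auto simp: mi_def split: if_splits)
  qed simp
  have hi: "(\<Sum>p=1..N. hi p) \<le> 2 * A"
  proof (cases "\<exists>p\<ge>1. 1 \<le> u p * \<tau>")
    case False
    then have "(\<Sum>p=1..N. hi p) = 0" by (intro sum.neutral) (auto simp: hi_def)
    then show ?thesis using A by simp
  next
    case True
    \<comment> \<open>The first index at or above the threshold. Condition (L) at \<open>m\<close>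
      bounds the reciprocals from there on by \<open>A / u m\<close>, and
      \<open>1 \<le> u m * \<tau>\<close> absorbs the remaining factor.\<close>
    define m where "m = (LEAST p. 1 \<le> p \<and> 1 \<le> u p * \<tau>)"
    have m: "1 \<le> m" "1 \<le> u m * \<tau>"
      using LeastI_ex[of "\<lambda>p. 1 \<le> p \<and> 1 \<le> u p * \<tau>"] True unfolding m_def by auto
    have small: "hi p = 0" if "1 \<le> p" "p < m" for p
      using not_less_Least[of p "\<lambda>p. 1 \<le> p \<and> 1 \<le> u p * \<tau>"] that unfolding m_def hi_def by auto
    have \<tau>0: "0 < \<tau>" using m \<tau> by (cases "\<tau> = 0") auto
    have "(\<Sum>p=1..N. hi p) = (\<Sum>p\<in>{1..N} \<inter> {m..}. hi p)"
      by (rule sum.mono_neutral_right) (use small in auto)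
    also have "\<dots> \<le> (\<Sum>p\<in>{1..N} \<inter> {m..}. 2 / (u p * \<tau>))"
    proof (rule sum_mono)
      fix p assume "p \<in> {1..N} \<inter> {m..}"
      then have "0 < u p" using pos by auto
      then show "hi p \<le> 2 / (u p * \<tau>)" using \<tau> by (auto simp: hi_def)
    qed
    also have "\<dots> \<le> (\<Sum>p\<in>{m..<m + Suc N}. 2 / (u p * \<tau>))"
    proof (rule sum_mono2)
      fix p assume "p \<in> {m..<m + Suc N} - ({1..N} \<inter> {m..})"
      then have "0 < u p" using pos m(1) by auto
      then show "0 \<le> 2 / (u p * \<tau>)" using \<tau> by simp
    qed auto
    also have "\<dots> = (\<Sum>j<Suc N. 2 / (u (m + j) * \<tau>))"
      by (simp only: sum.atLeastLessThan_shift_0[of _ m] o_def atLeast0LessThan add_diff_cancel_left')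
    also have "\<dots> = (2 / \<tau>) * (\<Sum>j<Suc N. 1 / u (m + j))"
      unfolding sum_distrib_left by (intro sum.cong refl) (simp add: mult.commute)
    also have "\<dots> \<le> (2 / \<tau>) * (\<Sum>j. 1 / u (m + j))"
      using \<tau>0 pos m(1) by (intro mult_left_mono sum_le_suminf L) (auto intro: less_imp_le)
    also have "\<dots> \<le> (2 / \<tau>) * (A / u m)"
      using \<tau>0 L(2)[OF m(1)] pos[OF m(1)] by (intro mult_left_mono) (auto simp: field_simps)
    also have "\<dots> = 2 * A / (u m * \<tau>)" by (simp add: mult.commute)
    also have "\<dots> \<le> 2 * A / 1"
      using m A by (intro divide_left_mono) auto
    finally show ?thesis by simp
  qed
  have "(\<Sum>p=1..N. band_bound u t p) \<le> (\<Sum>p=1..N. lo p + mi p + hi p)"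
    by (intro sum_mono split) auto
  also have "\<dots> = (\<Sum>p=1..N. lo p) + (\<Sum>p=1..N. mi p) + (\<Sum>p=1..N. hi p)"
    by (simp add: sum.distrib)
  \<comment> \<open>The stated bound \<open>3 * A + 4\<close> is slightly weaker than this.\<close>
  also have "\<dots> \<le> 1 + 3 + 2 * A"
    using lo[of N] mi[of N] hi by (intro add_mono) (auto split: if_splits)
  finally show ?thesis using A by simp
qed

lemma band_bound_nonneg:
  assumes "0 < u p" "u p \<le> u (Suc p)"
  shows "0 \<le> band_bound u t p"
  using assms by (auto simp: band_bound_def)

lemma sum_band_bound_finite_le:
  assumes "cond_L A u" "finite F" "F \<subseteq> {1..}"
  shows "(\<Sum>p\<in>F. band_bound u t p) \<le> 3 * A + 4"
proof -
  obtain N where "F \<subseteq> {..N}" using finite_nat_iff_bounded_le assms(2) by blast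
  have "(\<Sum>p\<in>F. band_bound u t p) \<le> (\<Sum>p=1..N. band_bound u t p)"
  proof (rule sum_mono2)
    show "F \<subseteq> {1..N}" using assms(3) \<open>F \<subseteq> {..N}\<close> by auto
    fix p assume "p \<in> {1..N} - F"
    then show "0 \<le> band_bound u t p"
      using assms(1) by (intro band_bound_nonneg) (auto simp: cond_L_def intro: mono_onD)
  qed simp
  then show ?thesis using sum_band_bound_le[OF assms(1)] by (rule order_trans)
qed

section \<open>Summation over the frequency bands\<close>

text \<open>\<open>freq_rect\<close> consists of four disjoint boxes, one for each pair of signs,
  and the four products of integrals combine into a single product.\<close>

lemma has_integral_freq_rect:
  fixes k l :: "real \<Rightarrow> complex"
  assumes "0 < \<alpha>" "0 < \<beta>"
    and k: "continuous_on (- {0}) k" and l: "continuous_on (- {0}) l"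
  shows "((\<lambda>z. k (fst z) * l (snd z)) has_integral
    ((integral {- s..- \<alpha>} k + integral {\<alpha>..s} k) * (integral {- t..- \<beta>} l + integral {\<beta>..t} l)))
    (freq_rect \<alpha> \<beta> s t)"
proof -
  let ?N = "{- s..- \<alpha>}" and ?P = "{\<alpha>..s}" and ?N' = "{- t..- \<beta>}" and ?P' = "{\<beta>..t}"
  let ?k = "\<lambda>z. k (fst z) * l (snd z)"
  have cont: "continuous_on ?N k" "continuous_on ?P k" "continuous_on ?N' l" "continuous_on ?P' l"
    using assms by (auto intro: continuous_on_subset[OF k] continuous_on_subset[OF l])
  have "(?k has_integral (integral ?N k * integral ?N' l + integral ?N k * integral ?P' l))
      (?N \<times> ?N' \<union> ?N \<times> ?P')"
    by (intro has_integral_Un has_integral_product_cbox cont)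
      (use assms in \<open>auto intro!: negligible_subset[OF negligible_empty]\<close>)
  moreover have "(?k has_integral (integral ?P k * integral ?N' l + integral ?P k * integral ?P' l))
      (?P \<times> ?N' \<union> ?P \<times> ?P')"
    by (intro has_integral_Un has_integral_product_cbox cont)
      (use assms in \<open>auto intro!: negligible_subset[OF negligible_empty]\<close>)
  ultimately have "(?k has_integral ((integral ?N k * integral ?N' l + integral ?N k * integral ?P' l)
      + (integral ?P k * integral ?N' l + integral ?P k * integral ?P' l)))
      ((?N \<times> ?N' \<union> ?N \<times> ?P') \<union> (?P \<times> ?N' \<union> ?P \<times> ?P'))"
    by (rule has_integral_Un) (use assms in \<open>auto intro!: negligible_subset[OF negligible_empty]\<close>)
  moreover have "(?N \<times> ?N' \<union> ?N \<times> ?P') \<union> (?P \<times> ?N' \<union> ?P \<times> ?P') = freq_rect \<alpha> \<beta> s t"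
    using assms by (auto simp: freq_rect_def abs_real_def split: if_splits)
  ultimately show ?thesis by (simp add: algebra_simps)
qed

lemma osc_prim_times_character:
  "osc_prim \<xi> r * exp (\<i> * complex_of_real (x * \<xi>)) = \<i> * cis (\<xi> * (x - r)) / complex_of_real \<xi>"
  unfolding osc_prim_def osc_def cis_conv_exp
  by (simp add: exp_add[symmetric] mult_exp_exp algebra_simps)

lemma continuous_on_osc_character:
  "continuous_on (- {0}) (\<lambda>\<xi>. osc_prim \<xi> r * exp (\<i> * complex_of_real (x * \<xi>)))"
  unfolding osc_prim_times_character
  by (intro continuous_intros) auto

text \<open>Pairing \<xi> with \<open>- \<xi>\<close> cancels the cosine, which is odd after
  division by \<xi>, and doubles the sine; hence the result is real.\<close>

lemma band_integral_osc_character: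
  assumes "0 < \<alpha>"
  shows "integral {- s..- \<alpha>} (\<lambda>\<xi>. osc_prim \<xi> r * exp (\<i> * complex_of_real (x * \<xi>)))
    + integral {\<alpha>..s} (\<lambda>\<xi>. osc_prim \<xi> r * exp (\<i> * complex_of_real (x * \<xi>)))
    = complex_of_real (- 2 * freq_sine \<alpha> s (x - r))"
proof -
  define k where "k \<xi> = osc_prim \<xi> r * exp (\<i> * complex_of_real (x * \<xi>))" for \<xi>
  have k: "continuous_on (- {0}) k" unfolding k_def by (rule continuous_on_osc_character)
  have i1: "k integrable_on {\<alpha>..s}"
    by (rule integrable_continuous_interval, rule continuous_on_subset[OF k]) (use assms in auto)
  have i2: "(\<lambda>\<xi>. k (- \<xi>)) integrable_on {\<alpha>..s}"
    by (rule integrable_continuous_interval, rule continuous_on_compose2[OF k])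
      (use assms in \<open>auto intro!: continuous_intros\<close>)
  have "integral {- s..- \<alpha>} k = integral {\<alpha>..s} (\<lambda>\<xi>. k (- \<xi>))"
    using Henstock_Kurzweil_Integration.integral_reflect_real[of s \<alpha> "\<lambda>\<xi>. k (- \<xi>)"] by simp
  then have "integral {- s..- \<alpha>} k + integral {\<alpha>..s} k = integral {\<alpha>..s} (\<lambda>\<xi>. k (- \<xi>) + k \<xi>)"
    using integral_add[OF i2 i1] by simp
  also have "\<dots> = integral {\<alpha>..s} (\<lambda>\<xi>. complex_of_real (- 2 * (sin (\<xi> * (x - r)) / \<xi>)))"
  proof (rule integral_cong)
    fix \<xi> assume "\<xi> \<in> {\<alpha>..s}"
    then have "\<xi> \<noteq> 0" using assms by auto
    then show "k (- \<xi>) + k \<xi> = complex_of_real (- 2 * (sin (\<xi> * (x - r)) / \<xi>))"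
      unfolding k_def osc_prim_times_character by (simp add: complex_eq_iff Re_divide_of_real Im_divide_of_real)
  qed
  also have "\<dots> = complex_of_real (integral {\<alpha>..s} (\<lambda>\<xi>. - 2 * (sin (\<xi> * (x - r)) / \<xi>)))"
    by (rule integral_unique[OF has_integral_of_real[OF integrable_integral]])
      (intro integrable_on_mult_right freq_sine_integrable assms)
  also have "\<dots> = complex_of_real (- 2 * freq_sine \<alpha> s (x - r))"
    unfolding freq_sine_def by (simp only: Henstock_Kurzweil_Integration.integral_mult_right)
  finally show ?thesis unfolding k_def .
qed

text \<open>The inversion integral of a function sampled on the square of half-side
  \<open>R\<close>. The 4 is the product of two factors \<open>- 2\<close> and later cancels against
  \<open>4 * pi\<^sup>2\<close>.\<close>

definition band_sum :: "(real \<times> real \<Rightarrow> real) \<Rightarrow> real \<Rightarrow> real \<Rightarrow> real \<Rightarrow> nat \<Rightarrow>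
    real \<Rightarrow> real \<Rightarrow> real \<Rightarrow> real \<Rightarrow> real" where
  "band_sum f x y R N \<alpha> \<beta> s t = (\<Sum>i\<le>Suc N. \<Sum>j\<le>Suc N. uniform_pad_diff f (- R) R (- R) R N i j *
     (4 * freq_sine \<alpha> s (x - uniform_grid (- R) R N i) * freq_sine \<beta> t (y - uniform_grid (- R) R N j)))"

lemma padded_sum_has_integral_freq_rect:
  assumes "0 < \<alpha>" "0 < \<beta>"
  shows "((\<lambda>z. padded_sum f (osc_prim (fst z)) (osc_prim (snd z)) (- R) R (- R) R N *
      exp (\<i> * complex_of_real (x * fst z + y * snd z)))
    has_integral complex_of_real (band_sum f x y R N \<alpha> \<beta> s t)) (freq_rect \<alpha> \<beta> s t)"
proof -
  let ?d = "\<lambda>i j. complex_of_real (uniform_pad_diff f (- R) R (- R) R N i j)"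
  let ?g = "uniform_grid (- R) R N"
  have "((\<lambda>z. \<Sum>i\<le>Suc N. \<Sum>j\<le>Suc N. ?d i j *
      ((osc_prim (fst z) (?g i) * exp (\<i> * complex_of_real (x * fst z))) *
       (osc_prim (snd z) (?g j) * exp (\<i> * complex_of_real (y * snd z)))))
    has_integral (\<Sum>i\<le>Suc N. \<Sum>j\<le>Suc N. ?d i j *
      (complex_of_real (- 2 * freq_sine \<alpha> s (x - ?g i)) * complex_of_real (- 2 * freq_sine \<beta> t (y - ?g j)))))
    (freq_rect \<alpha> \<beta> s t)"
    unfolding band_integral_osc_character[OF assms(1), symmetric] band_integral_osc_character[OF assms(2), symmetric]
    by (intro has_integral_sum finite_atMost has_integral_mult_right
        has_integral_freq_rect[OF assms] continuous_on_osc_character)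
  moreover have "(\<Sum>i\<le>Suc N. \<Sum>j\<le>Suc N. ?d i j *
      ((osc_prim (fst z) (?g i) * exp (\<i> * complex_of_real (x * fst z))) *
       (osc_prim (snd z) (?g j) * exp (\<i> * complex_of_real (y * snd z)))))
     = padded_sum f (osc_prim (fst z)) (osc_prim (snd z)) (- R) R (- R) R N *
      exp (\<i> * complex_of_real (x * fst z + y * snd z))" for z
  proof -
    have "exp (\<i> * complex_of_real (x * fst z + y * snd z)) =
        exp (\<i> * complex_of_real (x * fst z)) * exp (\<i> * complex_of_real (y * snd z))"
      by (simp add: exp_add distrib_left)
    then show ?thesis
      unfolding padded_sum_def sum_distrib_right by (intro sum.cong refl) (simp only: mult_ac)
  qed
  moreover have "(\<Sum>i\<le>Suc N. \<Sum>j\<le>Suc N. ?d i j *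
      (complex_of_real (- 2 * freq_sine \<alpha> s (x - ?g i)) * complex_of_real (- 2 * freq_sine \<beta> t (y - ?g j))))
     = complex_of_real (band_sum f x y R N \<alpha> \<beta> s t)"
    unfolding band_sum_def of_real_sum by (intro sum.cong refl) simp
  ultimately show ?thesis by simp
qed

section \<open>Estimates uniform in the sampling grid\<close>

text \<open>The terms are nonnegative, so \<open>F\<close> may be enlarged to the product of its
  projections, on which the sum factors. The shift to \<open>i - 1\<close> is injective because the
  indices start at 2.\<close>

lemma sum_band_products_le:
  assumes "cond_L A1 u" "cond_L A2 v" "finite F" "F \<subseteq> {2..} \<times> {2..}"
  shows "(\<Sum>(i, j)\<in>F. band_bound u a (i - 1) * band_bound v b (j - 1)) \<le> (3 * A1 + 4) * (3 * A2 + 4)"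
proof -
  have nonneg: "0 \<le> band_bound w c (i - 1)" if "cond_L A w" "2 \<le> i" for A w c i
    using that by (intro band_bound_nonneg) (auto simp: cond_L_def intro: mono_onD)
  have single: "(\<Sum>i\<in>I. band_bound w c (i - 1)) \<le> 3 * A + 4"
    if "cond_L A w" "finite I" "I \<subseteq> {2..}" for A w c I
  proof -
    have "inj_on (\<lambda>i. i - 1) I" using that(3) by (fastforce simp: inj_on_def)
    then have "(\<Sum>i\<in>I. band_bound w c (i - 1)) = (\<Sum>p\<in>(\<lambda>i. i - 1) ` I. band_bound w c p)"
      by (simp add: sum.reindex)
    also have "\<dots> \<le> 3 * A + 4"
      by (rule sum_band_bound_finite_le[OF that(1)]) (use that in auto)
    finally show ?thesis .
  qed
  have F: "finite (fst ` F)" "finite (snd ` F)" "fst ` F \<subseteq> {2..}" "snd ` F \<subseteq> {2..}"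
    using assms(3,4) by auto
  have "(\<Sum>(i, j)\<in>F. band_bound u a (i - 1) * band_bound v b (j - 1)) \<le>
      (\<Sum>(i, j)\<in>fst ` F \<times> snd ` F. band_bound u a (i - 1) * band_bound v b (j - 1))"
  proof (rule sum_mono2)
    show "F \<subseteq> fst ` F \<times> snd ` F" by force
    fix z assume "z \<in> fst ` F \<times> snd ` F - F"
    then have "2 \<le> fst z" "2 \<le> snd z" using F(3,4) by auto
    then show "0 \<le> (case z of (i, j) \<Rightarrow> band_bound u a (i - 1) * band_bound v b (j - 1))"
      using nonneg[OF assms(1)] nonneg[OF assms(2)] by (simp add: case_prod_beta)
  qed (use F in simp)
  also have "\<dots> = (\<Sum>i\<in>fst ` F. band_bound u a (i - 1)) * (\<Sum>j\<in>snd ` F. band_bound v b (j - 1))"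
    by (simp add: sum_product sum.cartesian_product)
  also have "\<dots> \<le> (3 * A1 + 4) * (3 * A2 + 4)"
  proof (rule mult_mono)
    show "0 \<le> 3 * A1 + 4" using assms(1) by (simp add: cond_L_def)
    show "0 \<le> (\<Sum>j\<in>snd ` F. band_bound v b (j - 1))"
      using F(4) nonneg[OF assms(2)] by (intro sum_nonneg) auto
  qed (use single assms F in auto)
  finally show ?thesis .
qed

text \<open>The majorants \<open>band_bound\<close> do not involve \<open>s\<close> and
  \<open>t\<close>, so every choice of end points is covered. Interchanging the sums puts the bands
  inside: for each fixed pair of sample coordinates they sum to at most a constant, and the weights
  outside total at most \<open>B\<close>.\<close>

lemma sum_abs_band_sum_le:
  assumes "grid_bounded f B" "(f \<longlongrightarrow> 0) at_infinity" "0 < R"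
    and uv: "cond_L A1 u" "cond_L A2 v" and F: "finite F" "F \<subseteq> {2..} \<times> {2..}"
    and s: "\<And>i j. (i, j) \<in> F \<Longrightarrow> s (i, j) \<in> {u (i - 1)..u i}"
    and t: "\<And>i j. (i, j) \<in> F \<Longrightarrow> t (i, j) \<in> {v (j - 1)..v j}"
  shows "(\<Sum>(i, j)\<in>F. \<bar>band_sum f x y R N (u (i - 1)) (v (j - 1)) (s (i, j)) (t (i, j))\<bar>)
    \<le> 4 * ((3 * A1 + 4) * (3 * A2 + 4)) * B"
proof -
  let ?g = "uniform_grid (- R) R N"
  let ?d = "\<lambda>k l. \<bar>uniform_pad_diff f (- R) R (- R) R N k l\<bar>"
  let ?b = "\<lambda>k l i j. band_bound u (x - ?g k) (i - 1) * band_bound v (y - ?g l) (j - 1)"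
  have one: "\<bar>band_sum f x y R N (u (i - 1)) (v (j - 1)) (s (i, j)) (t (i, j))\<bar> \<le>
      (\<Sum>k\<le>Suc N. \<Sum>l\<le>Suc N. ?d k l * (4 * ?b k l i j))" if "(i, j) \<in> F" for i j
  proof -
    have ij: "2 \<le> i" "2 \<le> j" using that F(2) by auto
    then have pos: "0 < u (i - 1)" "0 < v (j - 1)" using uv by (auto simp: cond_L_def)
    have S: "s (i, j) \<in> {u (i - 1)..u (Suc (i - 1))}" "t (i, j) \<in> {v (j - 1)..v (Suc (j - 1))}"
      using s[OF that] t[OF that] ij by auto
    show ?thesis
      unfolding band_sum_def
    proof (intro order_trans[OF sum_abs] sum_mono)
      fix k l
      let ?P = "freq_sine (u (i - 1)) (s (i, j)) (x - ?g k)" and ?Q = "freq_sine (v (j - 1)) (t (i, j)) (y - ?g l)"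
      have "\<bar>?P\<bar> * \<bar>?Q\<bar> \<le> ?b k l i j"
        using abs_freq_sine_le_band_bound[OF pos(1) S(1)] abs_freq_sine_le_band_bound[OF pos(2) S(2)]
        by (intro mult_mono) (auto intro: order_trans[OF abs_ge_zero])
      then have "?d k l * (4 * (\<bar>?P\<bar> * \<bar>?Q\<bar>)) \<le> ?d k l * (4 * ?b k l i j)"
        by (intro mult_left_mono) auto
      then show "\<bar>uniform_pad_diff f (- R) R (- R) R N k l * (4 * ?P * ?Q)\<bar> \<le> ?d k l * (4 * ?b k l i j)"
        by (simp add: abs_mult mult.assoc)
    qed
  qed
  have "(\<Sum>(i, j)\<in>F. \<bar>band_sum f x y R N (u (i - 1)) (v (j - 1)) (s (i, j)) (t (i, j))\<bar>)
      \<le> (\<Sum>(i, j)\<in>F. \<Sum>k\<le>Suc N. \<Sum>l\<le>Suc N. ?d k l * (4 * ?b k l i j))"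
    by (rule sum_mono) (use one in auto)
  also have "\<dots> = (\<Sum>k\<le>Suc N. \<Sum>l\<le>Suc N. ?d k l * (4 * (\<Sum>(i, j)\<in>F. ?b k l i j)))"
    unfolding case_prod_beta sum_distrib_left
    by (subst sum.swap, intro sum.cong refl, subst sum.swap, rule refl)
  also have "\<dots> \<le> (\<Sum>k\<le>Suc N. \<Sum>l\<le>Suc N. ?d k l * (4 * ((3 * A1 + 4) * (3 * A2 + 4))))"
    by (intro sum_mono mult_left_mono sum_band_products_le[OF uv F]) auto
  also have "\<dots> = (4 * ((3 * A1 + 4) * (3 * A2 + 4))) * (\<Sum>k\<le>Suc N. \<Sum>l\<le>Suc N. ?d k l)"
    by (simp only: sum_distrib_right[symmetric] mult.commute)
  also have "\<dots> \<le> (4 * ((3 * A1 + 4) * (3 * A2 + 4))) * B"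
    using uv assms(3)
    by (intro mult_left_mono uniform_pad_diff_sum_le assms) (auto simp: cond_L_def)
  finally show ?thesis .
qed

section \<open>Passage to the limit in mesh and square\<close>

lemma freq_rect_nonzero:
  assumes "0 < \<alpha>" "0 < \<beta>" "z \<in> freq_rect \<alpha> \<beta> s t"
  shows "fst z \<noteq> 0" "snd z \<noteq> 0" "\<alpha> \<le> \<bar>fst z\<bar>" "\<beta> \<le> \<bar>snd z\<bar>"
  using assms by (auto simp: freq_rect_def)

context
  fixes f :: "real \<times> real \<Rightarrow> real" and B :: real
  assumes grid_bounded: "grid_bounded f B" and vanishing: "(f \<longlongrightarrow> 0) at_infinity"
begin

text \<open>The majorant \<open>B * (1 / \<bar>fst z\<bar> * (1 / \<bar>snd z\<bar>))\<close> is
  bounded on a frequency rectangle, which keeps away from both axes. This serves for refining the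
  sampling and again for enlarging the square.\<close>

lemma dominated_convergence_freq_rect:
  fixes g :: "nat \<Rightarrow> real \<times> real \<Rightarrow> complex"
  assumes \<alpha>: "0 < \<alpha>" "0 < \<beta>"
    and int: "\<And>N. (\<lambda>z. g N z * exp (\<i> * complex_of_real (x * fst z + y * snd z))) integrable_on freq_rect \<alpha> \<beta> s t"
    and le: "\<And>N z. \<lbrakk>fst z \<noteq> 0; snd z \<noteq> 0\<rbrakk> \<Longrightarrow> cmod (g N z) \<le> B * (1 / \<bar>fst z\<bar> * (1 / \<bar>snd z\<bar>))"
    and lim: "\<And>z. \<lbrakk>fst z \<noteq> 0; snd z \<noteq> 0\<rbrakk> \<Longrightarrow> (\<lambda>N. g N z) \<longlonglongrightarrow> h z"
  shows "(\<lambda>z. h z * exp (\<i> * complex_of_real (x * fst z + y * snd z))) integrable_on freq_rect \<alpha> \<beta> s t"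
    and "(\<lambda>N. integral (freq_rect \<alpha> \<beta> s t) (\<lambda>z. g N z * exp (\<i> * complex_of_real (x * fst z + y * snd z))))
      \<longlonglongrightarrow> integral (freq_rect \<alpha> \<beta> s t) (\<lambda>z. h z * exp (\<i> * complex_of_real (x * fst z + y * snd z)))"
proof -
  let ?e = "\<lambda>z. exp (\<i> * complex_of_real (x * fst z + y * snd z))"
  let ?c = "B * (1 / \<alpha> * (1 / \<beta>))"
  note B0 = grid_bound_nonneg[OF grid_bounded vanishing]
  have "(\<lambda>z :: real \<times> real. complex_of_real ?c * 1 :: complex) integrable_on freq_rect \<alpha> \<beta> s t"
    using has_integral_freq_rect[OF \<alpha>, of "\<lambda>_. complex_of_real ?c" "\<lambda>_. 1" s t] by (auto intro: has_integral_integrable)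
  from integrable_linear[OF this bounded_linear_Re]
  have const: "(\<lambda>z :: real \<times> real. ?c) integrable_on freq_rect \<alpha> \<beta> s t" by (simp add: o_def)
  have bound: "norm (g N z * ?e z) \<le> ?c" if z: "z \<in> freq_rect \<alpha> \<beta> s t" for N z
  proof -
    note nz = freq_rect_nonzero[OF \<alpha> z]
    have "norm (g N z * ?e z) \<le> B * (1 / \<bar>fst z\<bar> * (1 / \<bar>snd z\<bar>))"
      using le[OF nz(1,2)] by (simp add: norm_mult)
    also have "\<dots> \<le> ?c"
      using nz \<alpha> B0 by (intro mult_left_mono mult_mono divide_left_mono) auto
    finally show ?thesis .
  qed
  have conv: "(\<lambda>N. g N z * ?e z) \<longlonglongrightarrow> h z * ?e z" if z: "z \<in> freq_rect \<alpha> \<beta> s t" for z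
    using lim[OF freq_rect_nonzero(1,2)[OF \<alpha> z]] by (rule tendsto_mult_right)
  show "(\<lambda>z. h z * ?e z) integrable_on freq_rect \<alpha> \<beta> s t"
    by (rule dominated_convergence(1)[OF int const]) (rule bound conv, assumption)+
  show "(\<lambda>N. integral (freq_rect \<alpha> \<beta> s t) (\<lambda>z. g N z * ?e z)) \<longlonglongrightarrow> integral (freq_rect \<alpha> \<beta> s t) (\<lambda>z. h z * ?e z)"
    by (rule dominated_convergence(2)[OF int const]) (rule bound conv, assumption)+
qed

text \<open>Two successive limits: first the mesh tends to 0 on a fixed square, then the square
  grows. \<open>H\<close> holds the intermediate integrals of the truncated transforms.\<close>

lemma inversion_integrand_limits:
  assumes \<alpha>: "0 < \<alpha>" "0 < \<beta>"
  shows "inversion_integrand f x y integrable_on freq_rect \<alpha> \<beta> s t"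
    and "\<exists>H. (\<forall>R. (\<lambda>N. complex_of_real (band_sum f x y (real (Suc R)) N \<alpha> \<beta> s t)) \<longlonglongrightarrow> H R) \<and>
      H \<longlonglongrightarrow> integral (freq_rect \<alpha> \<beta> s t) (inversion_integrand f x y)"
proof -
  let ?e = "\<lambda>z. exp (\<i> * complex_of_real (x * fst z + y * snd z))"
  let ?r = "\<lambda>R. real (Suc R)"
  let ?T = "\<lambda>R z. KP_truncated f (fst z) (snd z) (- ?r R, ?r R, - ?r R, ?r R)"
  let ?p = "\<lambda>R N z. padded_sum f (osc_prim (fst z)) (osc_prim (snd z)) (- ?r R) (?r R) (- ?r R) (?r R) N"
  have pi: "((\<lambda>z. ?p R N z * ?e z) has_integral complex_of_real (band_sum f x y (?r R) N \<alpha> \<beta> s t)) (freq_rect \<alpha> \<beta> s t)" for R N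
    by (rule padded_sum_has_integral_freq_rect[OF \<alpha>])
  have pint: "(\<lambda>z. ?p R N z * ?e z) integrable_on freq_rect \<alpha> \<beta> s t" for R N
    using pi by blast
  have ple: "cmod (?p R N z) \<le> B * (1 / \<bar>fst z\<bar> * (1 / \<bar>snd z\<bar>))" for R N z
    by (rule norm_padded_sum_le[OF _ _ uniform_pad_diff_sum_le[OF grid_bounded vanishing]])
      (simp_all add: norm_osc_prim)
  have plim: "(\<lambda>N. ?p R N z) \<longlonglongrightarrow> ?T R z" if "fst z \<noteq> 0" "snd z \<noteq> 0" for R z
    by (rule padded_osc_sum_tendsto(2)[OF grid_bounded vanishing that]) auto
  note d1 = dominated_convergence_freq_rect[OF \<alpha> pint ple plim]
  have Tle: "cmod (?T R z) \<le> B * (1 / \<bar>fst z\<bar> * (1 / \<bar>snd z\<bar>))" if "fst z \<noteq> 0" "snd z \<noteq> 0" for R z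
    by (rule norm_KP_truncated_le_bound[OF grid_bounded vanishing that])
  have Tlim: "(\<lambda>R. ?T R z) \<longlonglongrightarrow> KP_Fourier f (fst z) (snd z)" if "fst z \<noteq> 0" "snd z \<noteq> 0" for z
    by (rule KP_truncated_tendsto_KP_Fourier[OF grid_bounded vanishing that])
  note d2 = dominated_convergence_freq_rect[OF \<alpha> d1(1) Tle Tlim]
  have eq: "inversion_integrand f x y = (\<lambda>z. KP_Fourier f (fst z) (snd z) * ?e z)"
    by (auto simp: inversion_integrand_def)
  show "inversion_integrand f x y integrable_on freq_rect \<alpha> \<beta> s t"
    unfolding eq by (rule d2(1))
  have "(\<lambda>N. complex_of_real (band_sum f x y (?r R) N \<alpha> \<beta> s t)) \<longlonglongrightarrow>
      integral (freq_rect \<alpha> \<beta> s t) (\<lambda>z. ?T R z * ?e z)" for R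
    using d1(2)[of R] unfolding integral_unique[OF pi] .
  then show "\<exists>H. (\<forall>R. (\<lambda>N. complex_of_real (band_sum f x y (real (Suc R)) N \<alpha> \<beta> s t)) \<longlonglongrightarrow> H R) \<and>
      H \<longlonglongrightarrow> integral (freq_rect \<alpha> \<beta> s t) (inversion_integrand f x y)"
    using d2(2) unfolding eq by (intro exI[of _ "\<lambda>R. integral (freq_rect \<alpha> \<beta> s t) (\<lambda>z. ?T R z * ?e z)"] conjI allI)
qed

text \<open>Since \<open>F\<close> is finite, the uniform estimate for sampled functions survives
  both limits.\<close>

lemma sum_norm_inversion_integral_le:
  assumes uv: "cond_L A1 u" "cond_L A2 v" and F: "finite F" "F \<subseteq> {2..} \<times> {2..}"
    and s: "\<And>i j. (i, j) \<in> F \<Longrightarrow> s (i, j) \<in> {u (i - 1)..u i}"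
    and t: "\<And>i j. (i, j) \<in> F \<Longrightarrow> t (i, j) \<in> {v (j - 1)..v j}"
  shows "(\<Sum>(i, j)\<in>F. cmod (complex_of_real (1 / (4 * pi\<^sup>2)) *
      integral (freq_rect (u (i - 1)) (v (j - 1)) (s (i, j)) (t (i, j))) (inversion_integrand f x y)))
    \<le> (3 * A1 + 4) * (3 * A2 + 4) / pi\<^sup>2 * B"
proof -
  let ?I = "\<lambda>z. integral (freq_rect (u (fst z - 1)) (v (snd z - 1)) (s z) (t z)) (inversion_integrand f x y)"
  let ?b = "\<lambda>R N z. band_sum f x y (real (Suc R)) N (u (fst z - 1)) (v (snd z - 1)) (s z) (t z)"
  have "\<exists>H. (\<forall>R. (\<lambda>N. complex_of_real (?b R N z)) \<longlonglongrightarrow> H R) \<and> H \<longlonglongrightarrow> ?I z" if "z \<in> F" for z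
  proof -
    have "2 \<le> fst z" "2 \<le> snd z" using that F(2) by auto
    then have "0 < u (fst z - 1)" "0 < v (snd z - 1)" using uv by (auto simp: cond_L_def)
    then show ?thesis by (rule inversion_integrand_limits(2))
  qed
  then obtain H where H: "\<And>z R. z \<in> F \<Longrightarrow> (\<lambda>N. complex_of_real (?b R N z)) \<longlonglongrightarrow> H z R"
    "\<And>z. z \<in> F \<Longrightarrow> H z \<longlonglongrightarrow> ?I z"
    by metis
  let ?C = "4 * ((3 * A1 + 4) * (3 * A2 + 4)) * B"
  have "(\<Sum>z\<in>F. cmod (H z R)) \<le> ?C" for R
  proof (rule LIMSEQ_le_const2)
    show "(\<lambda>N. \<Sum>z\<in>F. cmod (complex_of_real (?b R N z))) \<longlonglongrightarrow> (\<Sum>z\<in>F. cmod (H z R))"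
      by (intro tendsto_sum tendsto_norm H)
    show "\<exists>N0. \<forall>N\<ge>N0. (\<Sum>z\<in>F. cmod (complex_of_real (?b R N z))) \<le> ?C"
      using sum_abs_band_sum_le[OF grid_bounded vanishing _ uv F s t, of "real (Suc R)" x y]
      by (auto simp: case_prod_beta)
  qed
  then have "(\<Sum>z\<in>F. cmod (?I z)) \<le> ?C"
    by (intro LIMSEQ_le_const2[OF tendsto_sum[OF tendsto_norm[OF H(2)]]]) auto
  then have "(1 / (4 * pi\<^sup>2)) * (\<Sum>z\<in>F. cmod (?I z)) \<le> (1 / (4 * pi\<^sup>2)) * ?C"
    by (intro mult_left_mono) auto
  also have "\<dots> = (3 * A1 + 4) * (3 * A2 + 4) / pi\<^sup>2 * B" by simp
  finally show ?thesis
    by (simp add: sum_distrib_left case_prod_beta norm_mult norm_divide norm_power)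
qed

end

section \<open>Suprema and infinite sums\<close>

text \<open>This allows the estimate to be made for fixed end points of the bands, with the suprema
  taken only afterwards.\<close>

lemma sum_SUP_le_of_choices:
  fixes g :: "'a \<Rightarrow> 'b \<Rightarrow> ennreal"
  assumes "finite F" "\<And>a. a \<in> F \<Longrightarrow> S a \<noteq> {}"
    and "\<And>ch. (\<And>a. a \<in> F \<Longrightarrow> ch a \<in> S a) \<Longrightarrow> (\<Sum>a\<in>F. g a (ch a)) \<le> C"
  shows "(\<Sum>a\<in>F. SUP s\<in>S a. g a s) \<le> C"
proof -
  \<comment> \<open>The accumulator \<open>D\<close> absorbs the terms whose point is already fixed;
    adding a constant commutes with a nonempty supremum.\<close>
  have "D + (\<Sum>a\<in>F. SUP s\<in>S a. g a s) \<le> C"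
    if "\<And>ch. (\<And>a. a \<in> F \<Longrightarrow> ch a \<in> S a) \<Longrightarrow> D + (\<Sum>a\<in>F. g a (ch a)) \<le> C" for D
    using assms(1,2) that
  proof (induction F arbitrary: D rule: finite_induct)
    case empty
    then show ?case by simp
  next
    case (insert b F)
    have "D + g b s + (\<Sum>a\<in>F. SUP s\<in>S a. g a s) \<le> C" if "s \<in> S b" for s
    proof (rule insert.IH)
      fix ch assume "\<And>a. a \<in> F \<Longrightarrow> ch a \<in> S a"
      then have "D + (\<Sum>a\<in>insert b F. g a ((ch(b := s)) a)) \<le> C"
        using that by (intro insert.prems(2)) auto
      moreover have "(\<Sum>a\<in>F. g a ((ch(b := s)) a)) = (\<Sum>a\<in>F. g a (ch a))"
        using insert.hyps(2) by (intro sum.cong) auto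
      ultimately show "D + g b s + (\<Sum>a\<in>F. g a (ch a)) \<le> C"
        using insert.hyps by (simp add: add.assoc)
    qed (use insert.prems in auto)
    then have "(SUP s\<in>S b. g b s + (D + (\<Sum>a\<in>F. SUP s\<in>S a. g a s))) \<le> C"
      by (intro SUP_least) (simp add: ac_simps)
    then have "(SUP s\<in>S b. g b s) + (D + (\<Sum>a\<in>F. SUP s\<in>S a. g a s)) \<le> C"
      using insert.prems(1) by (subst (asm) ennreal_SUP_add_left) auto
    then show ?case using insert.hyps by (simp add: ac_simps)
  qed
  from this[of 0] show ?thesis using assms(3) by simp
qed

theorem theorem4p2:
  fixes f :: "real \<times> real \<Rightarrow> real"
    and u v :: "nat \<Rightarrow> real"
    and A1 A2 x y :: real
  assumes "f \<in> BV_norm0"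
    and "cond_L A1 u"
    and "cond_L A2 v"
  shows "(\<forall>\<xi> \<eta>. \<xi> \<noteq> 0 \<longrightarrow> \<eta> \<noteq> 0 \<longrightarrow> KP_Fourier_exists f \<xi> \<eta>) \<and>
    (\<forall>i\<ge>2. \<forall>j\<ge>2. \<forall>s\<in>{u (i - 1)..u i}. \<forall>t\<in>{v (j - 1)..v j}.
       inversion_integrand f x y integrable_on freq_rect (u (i - 1)) (v (j - 1)) s t) \<and>
    (\<Sum>\<^sub>\<infinity>(i, j)\<in>{2..} \<times> {2..}.
       SUP s\<in>{u (i - 1)..u i}. SUP t\<in>{v (j - 1)..v j}.
         ennreal (cmod (complex_of_real (1 / (4 * pi\<^sup>2)) *
           integral (freq_rect (u (i - 1)) (v (j - 1)) s t) (inversion_integrand f x y))))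
    \<le> ennreal ((3 * A1 + 4) * (3 * A2 + 4) / pi\<^sup>2) * vitali_var f"
proof (intro conjI allI impI ballI)
  define V where "V = enn2real (vitali_var f)"
  have fV: "grid_bounded f V" and f0: "(f \<longlongrightarrow> 0) at_infinity" and V: "vitali_var f = ennreal V"
    using assms(1) BV_V_grid_bounded by (auto simp: BV_norm0_def V_def BV_V_def)
  note uv = assms(2,3)
  have pos: "0 < u (i - 1)" if "2 \<le> i" for i using uv that by (auto simp: cond_L_def)
  have pos': "0 < v (i - 1)" if "2 \<le> i" for i using uv that by (auto simp: cond_L_def)
  have mono: "u (i - 1) \<le> u i" "v (i - 1) \<le> v i" if "2 \<le> i" for i
    using uv that by (auto simp: cond_L_def intro: mono_onD)
  show "KP_Fourier_exists f \<xi> \<eta>" if "\<xi> \<noteq> 0" "\<eta> \<noteq> 0" for \<xi> \<eta>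
    by (rule KP_Fourier_exists_nonzero[OF fV f0 that])
  show "inversion_integrand f x y integrable_on freq_rect (u (i - 1)) (v (j - 1)) s t"
    if "2 \<le> i" "2 \<le> j" for i j s t
    by (rule inversion_integrand_limits(1)[OF fV f0 pos[OF that(1)] pos'[OF that(2)]])
  let ?g = "\<lambda>i j s t. ennreal (cmod (complex_of_real (1 / (4 * pi\<^sup>2)) *
           integral (freq_rect (u (i - 1)) (v (j - 1)) s t) (inversion_integrand f x y)))"
  let ?k = "(3 * A1 + 4) * (3 * A2 + 4) / pi\<^sup>2"
  have k: "0 \<le> ?k" using uv by (auto simp: cond_L_def)
  show "(\<Sum>\<^sub>\<infinity>(i, j)\<in>{2..} \<times> {2..}. SUP s\<in>{u (i - 1)..u i}. SUP t\<in>{v (j - 1)..v j}. ?g i j s t)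
    \<le> ennreal ?k * vitali_var f"
  \<comment> \<open>Infinite sums in \<open>ennreal\<close> always exist, so bounding every finite
    partial sum is enough.\<close>
  proof (rule infsum_le_finite_sums)
    show "(\<lambda>(i, j). SUP s\<in>{u (i - 1)..u i}. SUP t\<in>{v (j - 1)..v j}. ?g i j s t) summable_on {2..} \<times> {2..}"
      by (rule nonneg_summable_on_complete) simp
    fix F :: "(nat \<times> nat) set" assume F: "finite F" "F \<subseteq> {2..} \<times> {2..}"
    have ne: "{u (fst z - 1)..u (fst z)} \<noteq> {}" "{v (snd z - 1)..v (snd z)} \<noteq> {}" if "z \<in> F" for z
      using F(2) that mono by auto
    have "(\<Sum>z\<in>F. SUP s\<in>{u (fst z - 1)..u (fst z)}. SUP t\<in>{v (snd z - 1)..v (snd z)}. ?g (fst z) (snd z) s t)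
        \<le> ennreal (?k * V)"
    \<comment> \<open>First all ends \<open>s\<close> are fixed, then all ends \<open>t\<close>.
      Both are functions on pairs, because the suprema are taken separately for each pair.\<close>
    proof (rule sum_SUP_le_of_choices[OF F(1) ne(1)])
      fix s assume s: "\<And>z. z \<in> F \<Longrightarrow> s z \<in> {u (fst z - 1)..u (fst z)}"
      show "(\<Sum>z\<in>F. SUP t\<in>{v (snd z - 1)..v (snd z)}. ?g (fst z) (snd z) (s z) t) \<le> ennreal (?k * V)"
      proof (rule sum_SUP_le_of_choices[OF F(1) ne(2)])
        fix t assume t: "\<And>z. z \<in> F \<Longrightarrow> t z \<in> {v (snd z - 1)..v (snd z)}"
        have "(\<Sum>(i, j)\<in>F. cmod (complex_of_real (1 / (4 * pi\<^sup>2)) *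
            integral (freq_rect (u (i - 1)) (v (j - 1)) (s (i, j)) (t (i, j))) (inversion_integrand f x y))) \<le> ?k * V"
          by (rule sum_norm_inversion_integral_le[OF fV f0 uv F]) (use s t in force)+
        then show "(\<Sum>z\<in>F. ?g (fst z) (snd z) (s z) (t z)) \<le> ennreal (?k * V)"
          by (simp add: case_prod_beta ennreal_leI)
      qed
    qed
    then show "(\<Sum>(i, j)\<in>F. SUP s\<in>{u (i - 1)..u i}. SUP t\<in>{v (j - 1)..v j}. ?g i j s t)
        \<le> ennreal ?k * vitali_var f"
      by (simp only: case_prod_beta' V ennreal_mult'[OF k])
  qed
qed

end
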